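(* With the notation of the context, let $N\ge2$ and $r\ge0$ be integers and let $\xi\in X[N]$, $\xi\notin\mathcal{R}$. (i) Let $s=(s_1,\dots,s_{\mathsf{D}_N})$ be a sequence of integers with $1\le s_1<\cdots<s_{\mathsf{D}_N}\le N$. Then $\Pi_{N,s}$ has a zero of order at least $N+1-s_{\mathsf{D}_N}$ at $\xi$. (ii) Let $\ell=\lfloor\frac rd\rfloor+1$. Then $\Delta_{N+r}$ has a zero of order at least $\ell(N+\ell-\mathsf{D}_{N+r})$ at $\xi$.
   Context: $k$ is an algebraically closed field of characteristic $p\ge0$, $X$ an irreducible smooth proper curve over $k$ of genus $g\ge2$, $\infty\in X(k)$, $J$ the jacobian of $X$, and $X$ is embedded in $J$ by $\xi\mapsto$ class of $[\xi]-[\infty]$. $J[N]$ is the group of points of $J(k)$ of order dividing $N$ and $X[N]=J[N]\cap X$. Let $d$ be a positive integer and $x\in k(X)$ a function finite away from $\infty$, with a pole of order exactly $d$ at $\infty$, such that $k(X)/k(x)$ is separable. Let $\pi:X\to\mathbb{P}^1$ be the morphism defined by $x$ and $\mathcal{R}$ its set of ramification points ($\infty\in\mathcal{R}$). $D=(D_n)_{n\ge0}$ is the Hasse-Schmidt derivation on $k(x)$, trivial on $k$, with $D_n$ $k$-linear and $D_n(x^m)=\binom mn x^{m-n}$ for $m\in\mathbb{Z}$, $n\ge0$; it extends uniquely to a Hasse-Schmidt derivation on $k(X)$. Let $0=\delta_1<\delta_2<\cdots$ be the pole orders at $\infty$ of functions regular on $X-\{\infty\}$; for each $n$ fix $y_n$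 regular on $X-\{\infty\}$ with a pole of order exactly $\delta_n$ at $\infty$. For $M\ge2$, $\mathsf{D}_M$ is the number of $n$ with $\delta_n\le M$, and $\mathcal{M}_M$ is the $\mathsf{D}_M\times M$ matrix with $(i,j)$ entry $D_{j-1}(y_i)$. For $1\le s_1<\cdots<s_{\mathsf{D}_M}\le M$, $\Pi_{M,s}$ is the minor of $\mathcal{M}_M$ formed from columns $s_1,\dots,s_{\mathsf{D}_M}$, and $\Delta_M$ is the minor formed from the leftmost $\mathsf{D}_M$ columns ($s_i=i$). These minors are well-defined up to multiplication by a non-zero element of $k$ and are regular on $X-\mathcal{R}$. The zero function is regarded as having a zero of infinite order at every point. *)

theory Defs
  imports
    "Jordan_Normal_Form.Determinant"
    "Jordan_Normal_Form.DL_Submatrix"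
    "HOL-Algebra.Free_Abelian_Groups"
    "HOL-Algebra.Coset"
begin

section \<open>Curves\<close>

text \<open>
  An irreducible smooth proper curve over an algebraically closed field \<open>k\<close> is represented by its
  function field, as an abstract nonsingular curve (Hartshorne, Algebraic Geometry, I.6).  The ground
  field is a type \<open>'k\<close> of class \<open>alg_closed_field\<close>, the function field is a type \<open>'f\<close>, and
  \<open>emb :: 'k \<Rightarrow> 'f\<close> is the inclusion of the constants.
\<close>

definition ratfuns :: "('k::field \<Rightarrow> 'f::field) \<Rightarrow> 'f \<Rightarrow> 'f set" where
  "ratfuns emb t = {poly (map_poly emb p) t / poly (map_poly emb q) t | p q.
     poly (map_poly emb q) t \<noteq> 0}"

definition transcendental_over :: "('k::field \<Rightarrow> 'f::field) \<Rightarrow> 'f \<Rightarrow> bool" where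
  "transcendental_over emb t \<longleftrightarrow> (\<forall>p. p \<noteq> 0 \<longrightarrow> poly (map_poly emb p) t \<noteq> 0)"

definition finite_ext_of :: "'f::field set \<Rightarrow> bool" where
  "finite_ext_of F \<longleftrightarrow>
     (\<exists>B. finite B \<and> (\<forall>f. \<exists>a. (\<forall>b\<in>B. a b \<in> F) \<and> f = (\<Sum>b\<in>B. a b * b)))"

definition function_field :: "('k::alg_closed_field \<Rightarrow> 'f::field) \<Rightarrow> bool" where
  "function_field emb \<longleftrightarrow>
     field_hom emb \<and> (\<exists>t. transcendental_over emb t \<and> finite_ext_of (ratfuns emb t))"

text \<open>
  The closed points of the curve correspond to the discrete valuation rings of \<open>'f\<close> over \<open>'k\<close>.  A
  point \<open>\<xi>\<close> is represented by its normalised valuation, so that \<open>\<xi> f\<close> is the order of \<open>f\<close> at \<open>\<xi>\<close>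
  for \<open>f \<noteq> 0\<close>.  The value \<open>\<xi> 0 = 0\<close> is a convention which makes the representation unique; the
  predicates below treat the zero function separately.
\<close>

type_synonym 'f point = "'f \<Rightarrow> int"

definition points :: "('k::field \<Rightarrow> 'f::field) \<Rightarrow> 'f point set" where
  "points emb = {\<xi>. \<xi> 0 = 0 \<and>
     (\<forall>c. c \<noteq> 0 \<longrightarrow> \<xi> (emb c) = 0) \<and>
     (\<forall>f g. f \<noteq> 0 \<longrightarrow> g \<noteq> 0 \<longrightarrow> \<xi> (f * g) = \<xi> f + \<xi> g) \<and>
     (\<forall>f g. f \<noteq> 0 \<longrightarrow> g \<noteq> 0 \<longrightarrow> f + g \<noteq> 0 \<longrightarrow> min (\<xi> f) (\<xi> g) \<le> \<xi> (f + g)) \<and>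
     (\<exists>f. f \<noteq> 0 \<and> \<xi> f = 1)}"

definition zero_of_order_ge :: "'f::field point \<Rightarrow> 'f \<Rightarrow> int \<Rightarrow> bool" where
  "zero_of_order_ge \<xi> f m \<longleftrightarrow> f = 0 \<or> m \<le> \<xi> f"

definition regular_at :: "'f::field point \<Rightarrow> 'f \<Rightarrow> bool" where
  "regular_at \<xi> f \<longleftrightarrow> f = 0 \<or> 0 \<le> \<xi> f"

definition pole_of_order :: "'f::field point \<Rightarrow> 'f \<Rightarrow> nat \<Rightarrow> bool" where
  "pole_of_order \<xi> f n \<longleftrightarrow> f \<noteq> 0 \<and> \<xi> f = - int n"

definition regular_away_from :: "('k::field \<Rightarrow> 'f::field) \<Rightarrow> 'f point \<Rightarrow> 'f \<Rightarrow> bool" where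
  "regular_away_from emb infty f \<longleftrightarrow> (\<forall>\<xi>\<in>points emb - {infty}. regular_at \<xi> f)"


section \<open>Divisors, genus and the jacobian\<close>

abbreviation divisors :: "('k::field \<Rightarrow> 'f::field) \<Rightarrow> ('f point \<Rightarrow>\<^sub>0 int) monoid" where
  "divisors emb \<equiv> free_Abelian_group (points emb)"

definition divisor_degree :: "('f point \<Rightarrow>\<^sub>0 int) \<Rightarrow> int" where
  "divisor_degree A = (\<Sum>\<xi>\<in>Poly_Mapping.keys A. Poly_Mapping.lookup A \<xi>)"

definition riemann_roch_space :: "('k::field \<Rightarrow> 'f::field) \<Rightarrow> ('f point \<Rightarrow>\<^sub>0 int) \<Rightarrow> 'f set" where
  "riemann_roch_space emb A =
     {f. \<forall>\<xi>\<in>points emb. zero_of_order_ge \<xi> f (- Poly_Mapping.lookup A \<xi>)}"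

text \<open>
  The genus of a function field, as in Stichtenoth, Algebraic Function Fields and Codes, 1.4: the
  maximum of \<open>deg A - dim L(A) + 1\<close> over all divisors \<open>A\<close>, which exists by Riemann's theorem.
\<close>

definition genus :: "('k::field \<Rightarrow> 'f::field) \<Rightarrow> int" where
  "genus emb = (SUP A\<in>carrier (divisors emb).
     divisor_degree A - int (vector_space.dim (\<lambda>c f. emb c * f) (riemann_roch_space emb A)) + 1)"

definition principal_divisors :: "('k::field \<Rightarrow> 'f::field) \<Rightarrow> ('f point \<Rightarrow>\<^sub>0 int) set" where
  "principal_divisors emb = {A \<in> carrier (divisors emb).
     \<exists>f. f \<noteq> 0 \<and> (\<forall>\<xi>\<in>points emb. Poly_Mapping.lookup A \<xi> = \<xi> f)}"

definition divisors0 :: "('k::field \<Rightarrow> 'f::field) \<Rightarrow> ('f point \<Rightarrow>\<^sub>0 int) monoid" where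
  "divisors0 emb =
     (divisors emb)\<lparr>carrier := {A \<in> carrier (divisors emb). divisor_degree A = 0}\<rparr>"

text \<open>
  The group of \<open>k\<close>-points of the jacobian is the group of divisor classes of degree \<open>0\<close>.
\<close>

definition jacobian :: "('k::field \<Rightarrow> 'f::field) \<Rightarrow> ('f point \<Rightarrow>\<^sub>0 int) set monoid" where
  "jacobian emb = divisors0 emb Mod principal_divisors emb"

definition jacobian_embedding ::
    "('k::field \<Rightarrow> 'f::field) \<Rightarrow> 'f point \<Rightarrow> 'f point \<Rightarrow> ('f point \<Rightarrow>\<^sub>0 int) set" where
  "jacobian_embedding emb infty \<xi> =
     principal_divisors emb #>\<^bsub>divisors0 emb\<^esub> (frag_of \<xi> - frag_of infty)"

definition jacobian_torsion ::
    "('k::field \<Rightarrow> 'f::field) \<Rightarrow> nat \<Rightarrow> ('f point \<Rightarrow>\<^sub>0 int) set set" where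
  "jacobian_torsion emb N =
     {c \<in> carrier (jacobian emb). c [^]\<^bsub>jacobian emb\<^esub> N = \<one>\<^bsub>jacobian emb\<^esub>}"

definition torsion_points :: "('k::field \<Rightarrow> 'f::field) \<Rightarrow> 'f point \<Rightarrow> nat \<Rightarrow> 'f point set" where
  "torsion_points emb infty N =
     {\<xi> \<in> points emb. jacobian_embedding emb infty \<xi> \<in> jacobian_torsion emb N}"


section \<open>Separability and ramification\<close>

definition is_min_poly_over :: "'f::field set \<Rightarrow> 'f \<Rightarrow> 'f poly \<Rightarrow> bool" where
  "is_min_poly_over F f P \<longleftrightarrow>
     lead_coeff P = 1 \<and> (\<forall>i. coeff P i \<in> F) \<and> poly P f = 0 \<and>
     (\<forall>Q. Q \<noteq> 0 \<longrightarrow> (\<forall>i. coeff Q i \<in> F) \<longrightarrow> poly Q f = 0 \<longrightarrow> degree P \<le> degree Q)"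

definition separable_ext_of :: "'f::field set \<Rightarrow> bool" where
  "separable_ext_of F \<longleftrightarrow> (\<forall>f. \<exists>P. is_min_poly_over F f P \<and> coprime P (pderiv P))"

text \<open>
  The morphism to the projective line given by \<open>x\<close> has ramification index at \<open>\<xi>\<close> the order at \<open>\<xi>\<close>
  of a local parameter at the image point: \<open>1 / x\<close> if \<open>\<xi>\<close> is a pole of \<open>x\<close>, and otherwise
  \<open>x - c\<close> with \<open>c = x(\<xi>)\<close>.  For \<open>c \<noteq> x(\<xi>)\<close> the order of \<open>x - c\<close> is at most \<open>0\<close>.
\<close>

definition ramification_points :: "('k::field \<Rightarrow> 'f::field) \<Rightarrow> 'f \<Rightarrow> 'f point set" where
  "ramification_points emb x = {\<xi> \<in> points emb.
     (\<xi> x < 0 \<and> 2 \<le> \<xi> (1 / x)) \<or> (\<exists>c. 2 \<le> \<xi> (x - emb c))}"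


section \<open>Hasse-Schmidt derivations\<close>

definition hasse_schmidt :: "('k::field \<Rightarrow> 'f::field) \<Rightarrow> (nat \<Rightarrow> 'f \<Rightarrow> 'f) \<Rightarrow> bool" where
  "hasse_schmidt emb D \<longleftrightarrow>
     (\<forall>f. D 0 f = f) \<and>
     (\<forall>n f g. D n (f + g) = D n f + D n g) \<and>
     (\<forall>n c f. D n (emb c * f) = emb c * D n f) \<and>
     (\<forall>n f g. D n (f * g) = (\<Sum>i\<le>n. D i f * D (n - i) g)) \<and>
     (\<forall>n c. n \<ge> 1 \<longrightarrow> D n (emb c) = 0)"

text \<open>The division is exact.\<close>

definition int_binomial :: "int \<Rightarrow> nat \<Rightarrow> int" where
  "int_binomial m n = (\<Prod>i<n. m - int i) div fact n"

text \<open>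
  Only the values on powers of \<open>x\<close> are prescribed; when \<open>'f\<close> is separable over \<open>k(x)\<close> exactly one
  \<open>D\<close> satisfies this.
\<close>

definition hasse_schmidt_wrt :: "('k::field \<Rightarrow> 'f::field) \<Rightarrow> 'f \<Rightarrow> (nat \<Rightarrow> 'f \<Rightarrow> 'f) \<Rightarrow> bool" where
  "hasse_schmidt_wrt emb x D \<longleftrightarrow> hasse_schmidt emb D \<and>
     (\<forall>(m::int) n. D n (x powi m) = of_int (int_binomial m n) * x powi (m - int n))"


section \<open>Pole orders and minors\<close>

definition pole_orders :: "('k::field \<Rightarrow> 'f::field) \<Rightarrow> 'f point \<Rightarrow> nat set" where
  "pole_orders emb infty = {n. \<exists>f. regular_away_from emb infty f \<and> pole_of_order infty f n}"

text \<open>Indices of \<open>delta emb infty\<close> and of the functions \<open>y\<close> start at \<open>1\<close>.\<close>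

definition delta :: "('k::field \<Rightarrow> 'f::field) \<Rightarrow> 'f point \<Rightarrow> nat \<Rightarrow> nat" where
  "delta emb infty n = enumerate (pole_orders emb infty) (n - 1)"

definition num_pole_orders :: "('k::field \<Rightarrow> 'f::field) \<Rightarrow> 'f point \<Rightarrow> nat \<Rightarrow> nat" where
  "num_pole_orders emb infty M = card {n. n \<ge> 1 \<and> delta emb infty n \<le> M}"

text \<open>
  Matrix positions in \<open>mat\<close> and \<open>submatrix\<close> start at \<open>0\<close>, so the entry \<open>D\<^sub>j\<^sub>-\<^sub>1(y\<^sub>i)\<close> in row \<open>i\<close>
  and column \<open>j\<close> sits at position \<open>(i - 1, j - 1)\<close>.
\<close>

definition hs_matrix :: "('k::field \<Rightarrow> 'f::field) \<Rightarrow> 'f point \<Rightarrow> (nat \<Rightarrow> 'f \<Rightarrow> 'f) \<Rightarrow> (nat \<Rightarrow> 'f) \<Rightarrow>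
    nat \<Rightarrow> 'f mat" where
  "hs_matrix emb infty D y M = mat (num_pole_orders emb infty M) M (\<lambda>(i, j). D j (y (i + 1)))"

definition Pi_minor :: "('k::field \<Rightarrow> 'f::field) \<Rightarrow> 'f point \<Rightarrow> (nat \<Rightarrow> 'f \<Rightarrow> 'f) \<Rightarrow> (nat \<Rightarrow> 'f) \<Rightarrow>
    nat \<Rightarrow> (nat \<Rightarrow> nat) \<Rightarrow> 'f" where
  "Pi_minor emb infty D y M s =
     det (submatrix (hs_matrix emb infty D y M) UNIV
       ((\<lambda>i. s i - 1) ` {1..num_pole_orders emb infty M}))"

text \<open>
  The number of rows is at most the number \<open>M\<close> of columns as soon as the genus is positive, because
  then \<open>1\<close> is not a pole order.
\<close>

definition Delta_minor :: "('k::field \<Rightarrow> 'f::field) \<Rightarrow> 'f point \<Rightarrow> (nat \<Rightarrow> 'f \<Rightarrow> 'f) \<Rightarrow> (nat \<Rightarrow> 'f) \<Rightarrow>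
    nat \<Rightarrow> 'f" where
  "Delta_minor emb infty D y M = Pi_minor emb infty D y M (\<lambda>i. i)"

end

theory Submission
  imports Defs "Jordan_Normal_Form.Char_Poly" "HOL-Computational_Algebra.Formal_Power_Series"
begin

text \<open>
  That \<open>\<xi>\<close> is an \<open>N\<close>-torsion point means that some function \<open>f\<close> has divisor \<open>N[\<xi>] - N[\<infinity>]\<close>
  (\<open>torsion_function\<close>).  As \<open>\<xi>\<close> is unramified, \<open>t = x - x(\<xi>)\<close> is a local parameter, and the functions
  \<open>f t\<^sup>i\<close> vanish to order \<open>N + i\<close> at \<open>\<xi>\<close> and have a pole of order \<open>N + i d\<close> at infinity.  Those with
  \<open>i \<le> r div d\<close> may replace the rows with these pole orders in the matrix for \<open>N + r\<close>; the
  old minors are constant multiples of the new ones (\<open>det_change_basis\<close>).  Each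
  \<open>D n\<close> maps functions regular at \<open>\<xi>\<close> to such functions and lowers the order of vanishing by at most \<open>n\<close>
  (\<open>order_D\<close>).  Adding up the orders of the entries in the
  new rows for each term of the Leibniz formula gives both bounds (\<open>order_Pi_minor\<close>,
  \<open>order_Delta_minor\<close>).

  Two facts about curves carry this argument.

  That rows may be replaced requires that a function with poles only at infinity is a linear combination
  of the \<open>y n\<close> (\<open>pole_basis_span\<close>).  Subtracting multiples of the \<open>y n\<close> reduces this to the statement that
  a function that is regular everywhere and has a zero is \<open>0\<close>, hence to the existence of a pole of a
  nonconstant function (\<open>ex_pole\<close>).  By Zorn's lemma there is a valuation ring over the constants in which the
  inverse of the function is not a unit (\<open>ex_valuation_subring\<close>), and as the function field is finite over
  \<open>k(z)\<close> for a suitable \<open>z\<close>, every proper valuation ring is discrete and so belongs to a point (\<open>ex_point\<close>).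

  That \<open>D n\<close> preserves regularity at \<open>\<xi>\<close> is proved without completing the local ring.  It holds for
  functions that are simple roots, modulo the maximal ideal, of polynomials for which it holds
  (\<open>simple_root_stable\<close>).  A regular \<open>f\<close> satisfies a separable equation over \<open>k(t)\<close>; approximating \<open>f\<close> by
  an element \<open>q\<close> of \<open>k(t)\<close> to sufficiently high order and dividing \<open>f - q\<close> by a power of \<open>t\<close> produces such a
  simple root (\<open>separable_stable\<close>).
\<close>

section \<open>Subfields and rational functions\<close>

text \<open>
Intermediate fields such as \<open>k(t)\<close> are sets inside the fixed field \<open>'f\<close>, so that they can depend
on the function \<open>t\<close>.
\<close>

definition subfield_set :: "'f::field set \<Rightarrow> bool" where
  "subfield_set F \<longleftrightarrow> 1 \<in> F \<and> (\<forall>a\<in>F. \<forall>b\<in>F. a + b \<in> F \<and> a - b \<in> F \<and> a * b \<in> F \<and> a / b \<in> F)"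

definition algebraic_over :: "'f::field set \<Rightarrow> bool" where
  "algebraic_over F \<longleftrightarrow> (\<forall>f. \<exists>P. P \<noteq> 0 \<and> (\<forall>i. coeff P i \<in> F) \<and> poly P f = 0)"

lemma subfield_setD:
  assumes "subfield_set F"
  shows "0 \<in> F" "1 \<in> F"
    "\<And>a b. a \<in> F \<Longrightarrow> b \<in> F \<Longrightarrow> a + b \<in> F" "\<And>a b. a \<in> F \<Longrightarrow> b \<in> F \<Longrightarrow> a - b \<in> F"
    "\<And>a b. a \<in> F \<Longrightarrow> b \<in> F \<Longrightarrow> a * b \<in> F" "\<And>a b. a \<in> F \<Longrightarrow> b \<in> F \<Longrightarrow> a / b \<in> F"
  using assms unfolding subfield_set_def by (auto, metis diff_self)

lemma subfield_set_sum:
  assumes "subfield_set F" "\<And>i. i \<in> I \<Longrightarrow> a i \<in> F"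
  shows "sum a I \<in> F"
  using assms(2) by (induct I rule: infinite_finite_induct) (auto simp: subfield_setD[OF assms(1)])

lemma subfield_set_poly:
  assumes "subfield_set F" "\<And>i. coeff P i \<in> F" "a \<in> F"
  shows "poly P a \<in> F"
  using assms(2)
proof (induct P)
  case (pCons c P)
  have "c \<in> F" using pCons(3)[of 0] by simp
  moreover have "poly P a \<in> F" using pCons(2) pCons(3)[of "Suc _"] by simp
  ultimately show ?case by (simp add: subfield_setD[OF assms(1)] assms(3))
qed (simp add: subfield_setD[OF assms(1)])

locale constant_embedding =
  fixes emb :: "'k::alg_closed_field \<Rightarrow> 'f::field"
  assumes field_hom_emb: "field_hom emb"
begin

sublocale emb: field_hom emb by (rule field_hom_emb)
sublocale map_poly_emb: map_poly_comm_ring_hom emb ..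

lemmas emb_simps = emb.hom_add emb.hom_minus emb.hom_uminus emb.hom_mult emb.hom_inverse emb.hom_div emb.hom_zero emb.hom_one

abbreviation ev :: "'k poly \<Rightarrow> 'f \<Rightarrow> 'f" where "ev p z \<equiv> poly (map_poly emb p) z"

lemma ev_simps [simp]:
  "ev 0 z = 0" "ev 1 z = 1" "ev [:c:] z = emb c" "ev (pCons c p) z = emb c + z * ev p z"
  "ev (p + q) z = ev p z + ev q z" "ev (p - q) z = ev p z - ev q z" "ev (p * q) z = ev p z * ev q z"
  "ev (- p) z = - ev p z" "ev (p ^ n) z = ev p z ^ n"
  by (simp_all add: emb.map_poly_pCons_hom map_poly_emb.hom_add map_poly_emb.hom_minus
    map_poly_emb.hom_mult map_poly_emb.hom_uminus map_poly_emb.hom_power)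

lemma ratfunsE:
  assumes "h \<in> ratfuns emb z"
  obtains p q where "h = ev p z / ev q z" "ev q z \<noteq> 0"
  using assms unfolding ratfuns_def by blast

lemma ratfunsI: "ev q z \<noteq> 0 \<Longrightarrow> ev p z / ev q z \<in> ratfuns emb z"
  unfolding ratfuns_def by blast

lemma subfield_set_ratfuns: "subfield_set (ratfuns emb z)"
  unfolding subfield_set_def
proof (intro conjI ballI)
  show "1 \<in> ratfuns emb z" using ratfunsI[of 1 z 1] by simp
  fix a b assume "a \<in> ratfuns emb z" "b \<in> ratfuns emb z"
  then obtain p q p' q' where *: "a = ev p z / ev q z" "ev q z \<noteq> 0" "b = ev p' z / ev q' z" "ev q' z \<noteq> 0"
    by (metis ratfunsE)
  show "a + b \<in> ratfuns emb z"
    using ratfunsI[of "q * q'" z "p * q' + p' * q"] * by (simp add: add_frac_eq)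
  show "a - b \<in> ratfuns emb z"
    using ratfunsI[of "q * q'" z "p * q' - p' * q"] * by (simp add: diff_frac_eq)
  show "a * b \<in> ratfuns emb z"
    using ratfunsI[of "q * q'" z "p * p'"] * by simp
  show "a / b \<in> ratfuns emb z"
  proof (cases "ev p' z = 0")
    case True
    then show ?thesis using ratfunsI[of 1 z 0] * by simp
  next
    case False
    then show ?thesis using ratfunsI[of "q * p'" z "p * q'"] * by simp
  qed
qed

lemma poly_in_ratfuns: "ev p z \<in> ratfuns emb z"
  using ratfunsI[of 1 z p] by simp

lemma self_in_ratfuns: "z \<in> ratfuns emb z"
  using poly_in_ratfuns[of "[:0, 1:]" z] by simp

lemma emb_in_ratfuns: "emb c \<in> ratfuns emb z"
  using poly_in_ratfuns[of "[:c:]" z] by simp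

lemma ratfuns_subset:
  assumes "subfield_set F" "range emb \<subseteq> F" "t \<in> F"
  shows "ratfuns emb t \<subseteq> F"
proof
  fix h assume "h \<in> ratfuns emb t"
  moreover have "ev p t \<in> F" for p
    using assms by (intro subfield_set_poly) auto
  ultimately show "h \<in> F"
    by (metis ratfunsE subfield_setD(6)[OF assms(1)])
qed

text \<open>
Moving the coordinate to a point where it vanishes does not lose rational functions; this is how a
coordinate becomes a local parameter.
\<close>

lemma ratfuns_translate: "ratfuns emb t \<subseteq> ratfuns emb (t - emb c)"
proof (rule ratfuns_subset[OF subfield_set_ratfuns])
  show "range emb \<subseteq> ratfuns emb (t - emb c)" using emb_in_ratfuns by blast
  show "t \<in> ratfuns emb (t - emb c)" using poly_in_ratfuns[of "[:c, 1:]" "t - emb c"] by simp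
qed

lemma algebraic_over_mono: "algebraic_over F \<Longrightarrow> F \<subseteq> G \<Longrightarrow> algebraic_over G"
  unfolding algebraic_over_def by (meson subsetD)

end

section \<open>Valuation rings over the constants\<close>

text \<open>
Most arguments about a point use only the ring of functions regular there.  They are made for an
arbitrary valuation ring over the constants, because valuation rings also arise from Zorn's lemma
before they are known to belong to points.
\<close>

locale valuation_subring = constant_embedding emb
  for emb :: "'k::alg_closed_field \<Rightarrow> 'f::field" +
  fixes A :: "'f set"
  assumes emb_in: "emb c \<in> A"
    and add_in: "a \<in> A \<Longrightarrow> b \<in> A \<Longrightarrow> a + b \<in> A"
    and mult_in: "a \<in> A \<Longrightarrow> b \<in> A \<Longrightarrow> a * b \<in> A"
    and total: "a \<in> A \<or> inverse a \<in> A"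
begin

text \<open>
The maximal ideal.
\<close>

definition nonunits :: "'f set" where
  "nonunits = {a \<in> A. a = 0 \<or> inverse a \<notin> A}"

lemma zero_in: "0 \<in> A" and one_in: "1 \<in> A" and neg_in: "a \<in> A \<Longrightarrow> - a \<in> A"
  using emb_in[of 0] emb_in[of 1] mult_in[OF emb_in[of "-1"], of a] by (simp_all add: emb_simps)

lemma diff_in: "a \<in> A \<Longrightarrow> b \<in> A \<Longrightarrow> a - b \<in> A"
  using add_in neg_in by (metis diff_conv_add_uminus)

lemma power_in: "a \<in> A \<Longrightarrow> a ^ n \<in> A"
  by (induct n) (auto simp: one_in mult_in)

lemma sum_in: "(\<And>i. i \<in> I \<Longrightarrow> a i \<in> A) \<Longrightarrow> sum a I \<in> A"
  by (induct I rule: infinite_finite_induct) (auto simp: zero_in add_in)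

lemma poly_in: "(\<And>i. coeff P i \<in> A) \<Longrightarrow> a \<in> A \<Longrightarrow> poly P a \<in> A"
  unfolding poly_altdef by (intro sum_in mult_in power_in)

lemma ev_in: "a \<in> A \<Longrightarrow> ev p a \<in> A"
  by (rule poly_in) (auto simp: emb_in)

lemma nonunits_in: "a \<in> nonunits \<Longrightarrow> a \<in> A"
  unfolding nonunits_def by simp

lemma zero_nonunit: "0 \<in> nonunits"
  unfolding nonunits_def by (simp add: zero_in)

lemma not_in_iff: "a \<notin> A \<longleftrightarrow> a \<noteq> 0 \<and> inverse a \<in> nonunits"
  unfolding nonunits_def using total[of a] zero_in by auto

lemma unit_inverse: "a \<in> A \<Longrightarrow> a \<notin> nonunits \<Longrightarrow> a \<noteq> 0 \<and> inverse a \<in> A \<and> inverse a \<notin> nonunits"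
  unfolding nonunits_def by auto

lemma nonunits_mult:
  assumes "r \<in> A" "a \<in> nonunits"
  shows "r * a \<in> nonunits"
proof (rule ccontr)
  assume "r * a \<notin> nonunits"
  then have ra: "r * a \<noteq> 0" "inverse (r * a) \<in> A"
    using mult_in[OF assms(1) nonunits_in[OF assms(2)]] unfolding nonunits_def by auto
  have "r * inverse (r * a) \<in> A" using mult_in[OF assms(1) ra(2)] .
  moreover have "r * inverse (r * a) = inverse a" using ra(1) by (simp add: field_simps)
  ultimately have "inverse a \<in> A" by metis
  then show False using assms(2) ra(1) unfolding nonunits_def by auto
qed

lemma nonunits_add: "a \<in> nonunits \<Longrightarrow> b \<in> nonunits \<Longrightarrow> a + b \<in> nonunits"
proof -
  have *: "a + b \<in> nonunits" if "a \<in> nonunits" "b \<in> nonunits" "b \<noteq> 0" "a * inverse b \<in> A" for a b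
  proof -
    have "(a * inverse b + 1) * b \<in> nonunits"
      using that by (intro nonunits_mult add_in one_in)
    moreover have "(a * inverse b + 1) * b = a + b" using that(3) by (simp add: distrib_right)
    ultimately show ?thesis by simp
  qed
  assume ab: "a \<in> nonunits" "b \<in> nonunits"
  consider "a = 0 \<or> b = 0" | "a \<noteq> 0" "b \<noteq> 0" "a * inverse b \<in> A" | "a \<noteq> 0" "b \<noteq> 0" "b * inverse a \<in> A"
    using total[of "a * inverse b"] by (auto simp: mult.commute)
  then show ?thesis
    using *[of a b] *[of b a] ab by cases (auto simp: add.commute)
qed

lemma one_not_nonunit: "1 \<notin> nonunits"
  unfolding nonunits_def by (simp add: one_in)

lemma emb_nonunit:
  assumes "emb c \<in> nonunits"
  shows "c = 0"
proof (rule ccontr)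
  assume "c \<noteq> 0"
  then have "emb (inverse c) * emb c = 1" by (simp flip: emb.hom_mult)
  then show False using nonunits_mult[OF emb_in[of "inverse c"] assms] one_not_nonunit by simp
qed

lemma nonunits_neg: "a \<in> nonunits \<Longrightarrow> - a \<in> nonunits"
  using nonunits_mult[OF neg_in[OF one_in], of a] by simp

lemma nonunits_diff: "a \<in> nonunits \<Longrightarrow> b \<in> nonunits \<Longrightarrow> a - b \<in> nonunits"
  using nonunits_add nonunits_neg by (metis diff_conv_add_uminus)

lemma nonunits_sum: "(\<And>i. i \<in> I \<Longrightarrow> a i \<in> nonunits) \<Longrightarrow> sum a I \<in> nonunits"
  by (induct I rule: infinite_finite_induct) (auto simp: zero_nonunit nonunits_add)

lemma nonunits_prime:
  assumes "a \<in> A" "a * b \<in> nonunits" "a \<notin> nonunits"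
  shows "b \<in> nonunits"
proof -
  have "a \<noteq> 0" "inverse a \<in> A" using unit_inverse[OF assms(1,3)] by auto
  then show ?thesis using nonunits_mult[OF _ assms(2), of "inverse a"] by (simp flip: mult.assoc)
qed

lemma nonunits_power: "a \<in> nonunits \<Longrightarrow> 0 < n \<Longrightarrow> a ^ n \<in> nonunits"
  using nonunits_mult[OF power_in[OF nonunits_in], of a a "n - 1"] power_minus_mult[of n a] by simp

lemma mult_unit: "a \<in> A - nonunits \<Longrightarrow> b \<in> A - nonunits \<Longrightarrow> a * b \<in> A - nonunits"
  using nonunits_prime mult_in by blast

lemma inverse_unit: "a \<in> A - nonunits \<Longrightarrow> inverse a \<in> A - nonunits"
  using unit_inverse by blast

text \<open>
Divisibility is a total preorder, so finitely many terms have one of least value.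
\<close>

lemma dominant_term:
  assumes "finite I" "I \<noteq> {}" "\<And>i. i \<in> I \<Longrightarrow> T i \<noteq> 0"
  shows "\<exists>k\<in>I. \<forall>i\<in>I. T i / T k \<in> A"
  using assms
proof (induct I rule: finite_ne_induct)
  case (singleton x)
  then show ?case by (simp add: one_in)
next
  case (insert x I)
  then obtain k where k: "k \<in> I" "\<forall>i\<in>I. T i / T k \<in> A" by auto
  have nz: "T k \<noteq> 0" "T x \<noteq> 0" using insert k by auto
  show ?case
  proof (cases "T x / T k \<in> A")
    case True
    then show ?thesis using k by auto
  next
    case False
    then have *: "T k / T x \<in> A" using total[of "T x / T k"] by simp
    have "T i / T x \<in> A" if "i \<in> I" for i
      using mult_in[OF k(2)[rule_format, OF that] *] nz by simp
    then show ?thesis using nz by (auto simp: one_in)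
  qed
qed

lemma ex_normalizing_coeff:
  assumes "P \<noteq> 0"
  shows "\<exists>k\<le>degree P. coeff P k \<noteq> 0 \<and> (\<forall>i. coeff P i / coeff P k \<in> A)"
proof -
  let ?I = "{i. i \<le> degree P \<and> coeff P i \<noteq> 0}"
  obtain k where k: "k \<le> degree P" "coeff P k \<noteq> 0" "\<forall>i\<in>?I. coeff P i / coeff P k \<in> A"
    using dominant_term[of ?I "coeff P"] assms by (fastforce simp: Collect_conj_eq)
  have "coeff P i / coeff P k \<in> A" for i
    using k(3) le_degree[of P i] zero_in by (cases "coeff P i = 0") auto
  then show ?thesis using k(1,2) by blast
qed

text \<open>
Dividing by the dominant term leaves \<open>1\<close> plus an element of the maximal ideal.
\<close>

lemma sum_nonzero:
  assumes "finite I" "I \<noteq> {}" "\<And>i. i \<in> I \<Longrightarrow> T i \<noteq> 0"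
    and "\<And>i k. i \<in> I \<Longrightarrow> k \<in> I \<Longrightarrow> i \<noteq> k \<Longrightarrow> T i / T k \<notin> A - nonunits"
  shows "sum T I \<noteq> 0"
proof
  assume 0: "sum T I = 0"
  obtain k where k: "k \<in> I" "\<forall>i\<in>I. T i / T k \<in> A"
    using dominant_term[of I T] assms(1-3) by blast
  have "0 = (\<Sum>i\<in>I. T i / T k)" using 0 by (simp flip: sum_divide_distrib)
  also have "\<dots> = 1 + (\<Sum>i\<in>I - {k}. T i / T k)"
    using assms(1,3) k by (simp add: sum.remove)
  finally have "1 = - (\<Sum>i\<in>I - {k}. T i / T k)" by (simp add: eq_neg_iff_add_eq_0)
  moreover have "(\<Sum>i\<in>I - {k}. T i / T k) \<in> nonunits"
    using assms(4) k by (intro nonunits_sum) blast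
  ultimately show False using nonunits_neg one_not_nonunit by metis
qed

text \<open>
Valuation rings are integrally closed: if \<open>f\<close> had a pole, the leading term of the relation would
strictly dominate all others.
\<close>

lemma subfield_algebraic_in:
  assumes "subfield_set F" "F \<subseteq> A" "P \<noteq> 0" "\<And>i. coeff P i \<in> F" "poly P f = 0"
  shows "f \<in> A"
proof (rule ccontr)
  assume "f \<notin> A"
  then have f: "f \<noteq> 0" "inverse f \<in> nonunits" using not_in_iff by auto
  let ?g = "inverse f" and ?c = "lead_coeff P" and ?n = "degree P"
  have eq: "coeff P i * f ^ i * (?g ^ ?n / ?c) = coeff P i / ?c * ?g ^ (?n - i)" if "i \<le> ?n" for i
  proof -
    have "?g ^ ?n = ?g ^ (?n - i) * ?g ^ i" using that by (simp flip: power_add)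
    then show ?thesis using f(1) by (simp add: field_simps)
  qed
  have "0 = (\<Sum>i\<le>?n. coeff P i * f ^ i * (?g ^ ?n / ?c))"
    using assms(5) unfolding poly_altdef sum_distrib_right[symmetric] by simp
  also have "\<dots> = (\<Sum>i\<le>?n. coeff P i / ?c * ?g ^ (?n - i))"
    using eq by (intro sum.cong) auto
  also have "\<dots> = 1 + (\<Sum>i<?n. coeff P i / ?c * ?g ^ (?n - i))"
    using assms(3) by (simp add: lessThan_Suc_atMost[symmetric])
  finally have "1 = - (\<Sum>i<?n. coeff P i / ?c * ?g ^ (?n - i))" by (simp add: eq_neg_iff_add_eq_0)
  moreover have "(\<Sum>i<?n. coeff P i / ?c * ?g ^ (?n - i)) \<in> nonunits"
    using assms(2,4) f(2) subfield_setD(6)[OF assms(1)]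
    by (intro nonunits_sum nonunits_mult nonunits_power) auto
  ultimately show False using nonunits_neg one_not_nonunit by metis
qed

lemma eq_UNIV_if_algebraic:
  assumes "subfield_set F" "F \<subseteq> A" "algebraic_over F"
  shows "A = UNIV"
  using assms(3) subfield_algebraic_in[OF assms(1,2)] unfolding algebraic_over_def by blast

lemma transcendental_if_notin:
  assumes "f \<notin> A"
  shows "transcendental_over emb f"
  unfolding transcendental_over_def
proof (intro allI impI notI)
  fix p assume "p \<noteq> 0" "ev p f = 0"
  moreover have "subfield_set (range emb)"
    unfolding subfield_set_def by (auto simp flip: emb.hom_add emb.hom_minus emb.hom_mult emb.hom_div intro: range_eqI[of _ _ 1])
  moreover have "range emb \<subseteq> A" using emb_in by blast
  ultimately show False
    using subfield_algebraic_in[of "range emb" "map_poly emb p" f] assms by auto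
qed

text \<open>
Over an algebraically closed field \<open>p\<close> splits, and the maximal ideal is prime, so one of the linear
factors \<open>f - emb c\<close> lies in it.
\<close>

lemma residue_if_poly_nonunit:
  assumes "f \<in> A" "p \<noteq> 0" "ev p f \<in> nonunits"
  shows "\<exists>c. f - emb c \<in> nonunits"
  using assms(2,3)
proof (induct "degree p" arbitrary: p)
  case 0
  then obtain a where "p = [:a:]" by (metis degree_eq_zeroE)
  then show ?case using 0 emb_nonunit by auto
next
  case (Suc n)
  then obtain c where "poly p c = 0" using alg_closed_imp_poly_has_root[of p] by auto
  then obtain q where q: "p = [:- c, 1:] * q" by (metis dvdE poly_eq_0_iff_dvd)
  have "degree q = n"
    using Suc(2,3) unfolding q by (subst (asm) degree_mult_eq) auto
  have "(f - emb c) * ev q f \<in> nonunits" 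
  proof -
    have "ev p f = ev [:- c, 1:] f * ev q f" unfolding q by (rule ev_simps(7))
    also have "ev [:- c, 1:] f = f - emb c" by (simp add: emb_simps)
    finally show ?thesis using Suc(4) by simp
  qed
  then have "ev q f \<in> nonunits" if "f - emb c \<notin> nonunits"
    using nonunits_prime[OF diff_in[OF assms(1) emb_in]] that by blast
  moreover have "q \<noteq> 0" using Suc(3) q by auto
  ultimately show ?case using Suc(1)[of q] \<open>degree q = n\<close> by blast
qed

lemma residue_ev:
  assumes "z \<in> nonunits"
  shows "ev p z - emb (poly p 0) \<in> nonunits"
proof (cases p)
  case (pCons c q)
  then show ?thesis using nonunits_mult[OF ev_in[OF nonunits_in[OF assms]] assms, of q]
    by (simp add: mult.commute)
qed

lemma ev_unit:
  assumes "z \<in> nonunits" "poly p 0 \<noteq> 0"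
  shows "ev p z \<in> A - nonunits"
  using residue_ev[OF assms(1), of p] ev_in[OF nonunits_in[OF assms(1)], of p] assms(2)
    nonunits_diff[of "ev p z" "ev p z - emb (poly p 0)"] emb_nonunit by auto

text \<open>
The valuation of \<open>k(z)\<close> is determined by \<open>z\<close>: after the powers of \<open>z\<close> have been split off, numerator
and denominator have a nonzero constant term and are units.
\<close>

lemma ratfuns_unit_form:
  assumes z: "z \<in> nonunits" "z \<noteq> 0" and h: "h \<in> ratfuns emb z" "h \<noteq> 0"
  shows "\<exists>j p q. h = z powi j * (ev p z / ev q z) \<and> poly p 0 \<noteq> 0 \<and> poly q 0 \<noteq> 0"
proof -
  have split: "\<exists>n q. ev p z = z ^ n * ev q z \<and> poly q 0 \<noteq> 0" if p: "p \<noteq> 0" for p z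
  proof -
    obtain q where q: "p = [:- 0, 1:] ^ Polynomial.order 0 p * q" "\<not> [:- 0, 1:] dvd q"
      using order_decomp[OF p] by blast
    have "ev p z = ev ([:- 0, 1:] ^ Polynomial.order 0 p) z * ev q z"
      by (subst q(1)) (rule ev_simps(7))
    also have "ev ([:- 0, 1:] ^ Polynomial.order 0 p) z = z ^ Polynomial.order 0 p"
      unfolding ev_simps(9) by (simp add: emb_simps)
    finally show ?thesis using q(2) poly_eq_0_iff_dvd[of q 0] by blast
  qed
  obtain p q where pq: "h = ev p z / ev q z" "ev q z \<noteq> 0" using h(1) by (rule ratfunsE)
  then have "p \<noteq> 0" "q \<noteq> 0" using h(2) by auto
  obtain m p' where p': "ev p z = z ^ m * ev p' z" "poly p' 0 \<noteq> 0" using split[OF \<open>p \<noteq> 0\<close>] by blast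
  obtain n q' where q': "ev q z = z ^ n * ev q' z" "poly q' 0 \<noteq> 0" using split[OF \<open>q \<noteq> 0\<close>] by blast
  have "h = z powi (int m - int n) * (ev p' z / ev q' z)"
    using pq(1) p'(1) q'(1) z(2) by (simp add: power_int_diff)
  then show "\<exists>j p q. h = z powi j * (ev p z / ev q z) \<and> poly p 0 \<noteq> 0 \<and> poly q 0 \<noteq> 0"
    using p'(2) q'(2) by blast
qed

lemma ratio_unit: 
  assumes "z \<in> nonunits" "poly p 0 \<noteq> 0" "poly q 0 \<noteq> 0"
  shows "ev p z / ev q z \<in> A - nonunits"
  using mult_unit[OF ev_unit[OF assms(1,2)] inverse_unit[OF ev_unit[OF assms(1,3)]]]
  by (simp add: divide_inverse)

text \<open>
Otherwise all nonzero polynomials in \<open>t\<close> would be units, hence the field \<open>k(t)\<close> and with it its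
algebraic extension \<open>'f\<close> would be contained in \<open>A\<close>.
\<close>

lemma ex_center:
  assumes "A \<noteq> UNIV" "algebraic_over (ratfuns emb t)" "t \<in> A"
  shows "\<exists>c. t - emb c \<in> nonunits"
proof (rule ccontr)
  assume no: "\<not> ?thesis"
  have unit: "ev p t \<in> A - nonunits" if "p \<noteq> 0" for p
    using residue_if_poly_nonunit[OF assms(3) that] no ev_in[OF assms(3)] by blast
  have frac_in: "h \<in> A" if h: "h \<in> ratfuns emb t" for h
  proof -
    obtain p q where pq: "h = ev p t / ev q t" "ev q t \<noteq> 0" using h by (rule ratfunsE)
    then have "q \<noteq> 0" by auto
    then have "inverse (ev q t) \<in> A" using unit inverse_unit by blast
    then show ?thesis using mult_in ev_in[OF assms(3), of p] pq(1) by (simp add: divide_inverse)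
  qed
  then have "ratfuns emb t \<subseteq> A"
    using frac_in by blast
  then show False
    using eq_UNIV_if_algebraic[OF subfield_set_ratfuns _ assms(2)] assms(1) by blast
qed

text \<open>
The new coordinate is \<open>t - emb c\<close> if \<open>t\<close> is regular with value \<open>c\<close>, and \<open>1/t\<close> if \<open>t\<close> has a pole.
\<close>

lemma ex_nonunit_coordinate:
  assumes "A \<noteq> UNIV" "algebraic_over (ratfuns emb t)"
  shows "\<exists>z. z \<in> nonunits \<and> z \<noteq> 0 \<and> ratfuns emb t \<subseteq> ratfuns emb z"
proof -
  have "\<exists>z. z \<in> nonunits \<and> t \<in> ratfuns emb z"
  proof (cases "t \<in> A")
    case True
    then obtain c where c: "t - emb c \<in> nonunits" using ex_center assms by blast
    have "t \<in> ratfuns emb (t - emb c)" using ratfuns_translate self_in_ratfuns by blast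
    then show ?thesis using c by blast
  next
    case False
    have "t \<in> ratfuns emb (inverse t)"
      using subfield_setD(6)[OF subfield_set_ratfuns emb_in_ratfuns[of 1] self_in_ratfuns[of "inverse t"]]
      by (simp add: divide_inverse)
    then show ?thesis using False not_in_iff by blast
  qed
  then obtain z where z: "z \<in> nonunits" "t \<in> ratfuns emb z" by blast
  have sub: "ratfuns emb t \<subseteq> ratfuns emb z"
    using ratfuns_subset[OF subfield_set_ratfuns] emb_in_ratfuns z(2) by blast
  have "z \<noteq> 0"
  proof
    assume "z = 0"
    have "ratfuns emb z \<subseteq> A"
    proof
      fix h assume "h \<in> ratfuns emb z"
      then obtain p q where "h = ev p z / ev q z" by (rule ratfunsE)
      then have "h = emb (coeff p 0 / coeff q 0)" using \<open>z = 0\<close> by (simp add: poly_0_coeff_0 emb_simps)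
      then show "h \<in> A" by (simp add: emb_in)
    qed
    then show False
      using eq_UNIV_if_algebraic[OF subfield_set_ratfuns _ algebraic_over_mono[OF assms(2) sub]] assms(1) by blast
  qed
  then show ?thesis using z sub by blast
qed

lemma residue_ratfuns:
  assumes "z \<in> nonunits" "z \<noteq> 0" "h \<in> ratfuns emb z" "h \<in> A"
  shows "\<exists>c. h - emb c \<in> nonunits"
proof (cases "h \<in> nonunits")
  case True
  then show ?thesis by (intro exI[of _ 0]) simp
next
  case False
  then have "h \<noteq> 0" using zero_nonunit by auto
  then obtain j p q where h: "h = z powi j * (ev p z / ev q z)" "poly p 0 \<noteq> 0" "poly q 0 \<noteq> 0"
    using ratfuns_unit_form assms by metis
  have u: "ev p z / ev q z \<in> A - nonunits" using ratio_unit h assms by blast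
  have "j = 0"
  proof (rule ccontr)
    assume "j \<noteq> 0"
    then consider n where "j = int n" "n > 0" | n where "j = - int n" "n > 0"
      by (metis int_cases3 of_nat_0_less_iff)
    then show False
    proof cases
      case 1
      then have "h \<in> nonunits" using nonunits_mult[of "ev p z / ev q z" "z ^ n"] u nonunits_power[OF assms(1)] h(1)
        by (simp add: mult.commute)
      then show False using False by blast
    next
      case 2
      then have "h * z ^ n = ev p z / ev q z" using h(1) assms(2) by (simp add: power_int_minus field_simps)
      then show False using nonunits_mult[OF assms(4) nonunits_power[OF assms(1) 2(2)]] u by auto
    qed
  qed
  then have h': "h * ev q z = ev p z" using h(1) \<open>j = 0\<close> ev_unit[OF assms(1) h(3)] zero_nonunit by auto
  define c where "c = poly p 0 / poly q 0"
  have "emb c * emb (poly q 0) = emb (poly p 0)"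
    using h(3) unfolding c_def by (simp flip: emb.hom_mult)
  then have "(h - emb c) * ev q z = (ev p z - emb (poly p 0)) - emb c * (ev q z - emb (poly q 0))"
    using h' by (simp add: algebra_simps)
  also have "\<dots> \<in> nonunits"
    by (rule nonunits_diff[OF residue_ev nonunits_mult[OF emb_in residue_ev]]) (fact assms(1))+
  finally show ?thesis
    using nonunits_prime[OF diff_in[OF assms(4) emb_in[of c]]] ev_unit[OF assms(1) h(3)] by blast
qed

text \<open>
The residue field is that of the constants.  A relation for \<open>f\<close> over \<open>k(z)\<close>, scaled so that its
coefficients are regular and one of them is \<open>1\<close>, reduces to a nontrivial relation over the constants
modulo the maximal ideal.
\<close>

lemma ex_residue:
  assumes "A \<noteq> UNIV" "algebraic_over (ratfuns emb t)" "f \<in> A"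
  shows "\<exists>c. f - emb c \<in> nonunits"
proof -
  obtain z where z: "z \<in> nonunits" "z \<noteq> 0" "ratfuns emb t \<subseteq> ratfuns emb z"
    using ex_nonunit_coordinate[OF assms(1,2)] by blast
  let ?F = "ratfuns emb z"
  obtain P where P: "P \<noteq> 0" "\<And>i. coeff P i \<in> ?F" "poly P f = 0"
    using algebraic_over_mono[OF assms(2) z(3)] unfolding algebraic_over_def by metis
  obtain k where k: "coeff P k \<noteq> 0" "k \<le> degree P" and a: "\<And>i. coeff P i / coeff P k \<in> A"
    using ex_normalizing_coeff[OF P(1)] by blast
  have "\<exists>c. coeff P i / coeff P k - emb c \<in> nonunits" for i
    using residue_ratfuns[OF z(1,2) _ a] P(2) subfield_setD(6)[OF subfield_set_ratfuns] by blast
  then obtain c where c: "\<And>i. coeff P i / coeff P k - emb (c i) \<in> nonunits" by metis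
  define p where "p = (\<Sum>i\<le>degree P. monom (c i) i)"
  have "p \<noteq> 0"
  proof
    assume "p = 0"
    then have "coeff p k = 0" by simp
    then have "c k = 0" using k(2) unfolding p_def by (simp add: coeff_sum if_distrib sum.delta cong: if_cong)
    then show False using c[of k] k(1) one_not_nonunit by simp
  qed
  have ev_p: "ev p f = (\<Sum>i\<le>degree P. emb (c i) * f ^ i)"
    unfolding p_def by (simp add: map_poly_emb.hom_sum poly_sum map_poly_monom poly_monom)
  have "(\<Sum>i\<le>degree P. coeff P i / coeff P k * f ^ i) = poly P f / coeff P k"
    unfolding poly_altdef by (simp add: sum_divide_distrib)
  then have "ev p f = - (\<Sum>i\<le>degree P. f ^ i * (coeff P i / coeff P k - emb (c i)))"
    unfolding ev_p using P(3) by (simp add: algebra_simps sum_subtractf)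
  then have "ev p f \<in> nonunits"
    using c assms(3) by (auto intro!: nonunits_neg nonunits_sum nonunits_mult power_in)
  then show ?thesis using residue_if_poly_nonunit[OF assms(3) \<open>p \<noteq> 0\<close>] by blast
qed

end

section \<open>Discreteness of valuation rings in a function field\<close>

text \<open>
The dimension argument of linear algebra over a subfield that is given as a set, by elimination of one
spanning element at a time.
\<close>

lemma dependent_if_card_gt:
  fixes g :: "'i \<Rightarrow> 'f::field"
  assumes F: "subfield_set F" and "finite B"
    and "finite I" "card B < card I"
    and "\<And>i. i \<in> I \<Longrightarrow> \<exists>a. (\<forall>b\<in>B. a b \<in> F) \<and> g i = (\<Sum>b\<in>B. a b * b)"
  shows "\<exists>h. (\<forall>i\<in>I. h i \<in> F) \<and> (\<exists>i\<in>I. h i \<noteq> 0) \<and> (\<Sum>i\<in>I. h i * g i) = 0"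
  using assms(2-)
proof (induct B arbitrary: I g rule: finite_induct)
  case empty
  then have "I \<noteq> {}" "\<And>i. i \<in> I \<Longrightarrow> g i = 0" by auto
  then show ?case using subfield_setD(2)[OF F] by (intro exI[of _ "\<lambda>_. 1"]) auto
next
  case (insert b B)
  from insert.prems(3) have "\<forall>i\<in>I. \<exists>a. (\<forall>c\<in>insert b B. a c \<in> F) \<and> g i = (\<Sum>c\<in>insert b B. a c * c)" by blast
  from bchoice[OF this] obtain a
    where a: "\<forall>i\<in>I. (\<forall>c\<in>insert b B. a i c \<in> F) \<and> g i = (\<Sum>c\<in>insert b B. a i c * c)" ..
  have aF: "a i c \<in> F" if "i \<in> I" "c \<in> insert b B" for i c using a that by blast
  have g: "g i = a i b * b + (\<Sum>c\<in>B. a i c * c)" if "i \<in> I" for i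
    using a that insert.hyps by simp
  show ?case
  proof (cases "\<forall>i\<in>I. a i b = 0")
    case True
    then show ?thesis
      using insert.prems(1,2) insert.hyps aF g by (intro insert.hyps(3)) (auto intro!: exI[of _ "a _"])
  next
    case False
    then obtain k where k: "k \<in> I" "a k b \<noteq> 0" by blast
    define r where "r i = a i b / a k b" for i
    have rF: "r i \<in> F" if "i \<in> I" for i
      unfolding r_def using aF that k by (intro subfield_setD(6)[OF F]) auto
    let ?I = "I - {k}" and ?g = "\<lambda>i. g i - r i * g k"
    have "\<exists>h. (\<forall>i\<in>?I. h i \<in> F) \<and> (\<exists>i\<in>?I. h i \<noteq> 0) \<and> (\<Sum>i\<in>?I. h i * ?g i) = 0"
    proof (rule insert.hyps(3))
      show "finite ?I" using insert.prems by simp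
      show "card B < card ?I" using insert.prems insert.hyps k by simp
      fix i assume i: "i \<in> ?I"
      have "?g i = (a i b - r i * a k b) * b + ((\<Sum>c\<in>B. a i c * c) - r i * (\<Sum>c\<in>B. a k c * c))"
        using g i k by (simp add: algebra_simps)
      also have "a i b - r i * a k b = 0" using k(2) unfolding r_def by simp
      finally have "?g i = (\<Sum>c\<in>B. (a i c - r i * a k c) * c)"
        by (simp add: sum_distrib_left sum_subtractf left_diff_distrib mult.assoc)
      moreover have "\<forall>c\<in>B. a i c - r i * a k c \<in> F"
        using aF rF i k by (auto intro!: subfield_setD[OF F])
      ultimately show "\<exists>a. (\<forall>c\<in>B. a c \<in> F) \<and> ?g i = (\<Sum>c\<in>B. a c * c)"
        by (intro exI[of _ "\<lambda>c. a i c - r i * a k c"] conjI)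
    qed
    then obtain h where h: "\<forall>i\<in>?I. h i \<in> F" "\<exists>i\<in>?I. h i \<noteq> 0" "(\<Sum>i\<in>?I. h i * ?g i) = 0" by blast
    define h' where "h' i = (if i = k then 0 - (\<Sum>i\<in>?I. h i * r i) else h i)" for i
    have "0 - (\<Sum>i\<in>?I. h i * r i) \<in> F"
      using h(1) rF by (intro subfield_setD(1,4,5)[OF F] subfield_set_sum[OF F]) auto
    then have "h' i \<in> F" if "i \<in> I" for i
      unfolding h'_def using h(1) that by auto
    moreover have "(\<Sum>i\<in>I. h' i * g i) = h' k * g k + (\<Sum>i\<in>?I. h' i * g i)"
      using insert.prems(1) k(1) by (rule sum.remove)
    moreover have "(\<Sum>i\<in>?I. h' i * g i) = (\<Sum>i\<in>?I. h i * g i)"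
      unfolding h'_def by (intro sum.cong) auto
    moreover have "h' k * g k + (\<Sum>i\<in>?I. h i * g i) = (\<Sum>i\<in>?I. h i * ?g i)"
      unfolding h'_def by (simp add: sum_distrib_right sum_subtractf right_diff_distrib mult.assoc)
    moreover have "\<exists>i\<in>I. h' i \<noteq> 0" using h(2) unfolding h'_def by auto
    ultimately show ?thesis using h(3) by (intro exI[of _ h']) auto
  qed
qed

lemma algebraic_over_if_finite_ext:
  assumes F: "subfield_set F" and "finite_ext_of F"
  shows "algebraic_over F"
  unfolding algebraic_over_def
proof
  fix f
  obtain B where B: "finite B" "\<And>f. \<exists>a. (\<forall>b\<in>B. a b \<in> F) \<and> f = (\<Sum>b\<in>B. a b * b)"
    using assms(2) unfolding finite_ext_of_def by blast
  obtain h where h: "\<forall>i\<le>card B. h i \<in> F" "\<exists>i\<le>card B. h i \<noteq> 0" "(\<Sum>i\<le>card B. h i * f ^ i) = 0"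
    using dependent_if_card_gt[OF F B(1), where I = "{..card B}" and g = "\<lambda>i. f ^ i"] B(2) by auto
  define P where "P = (\<Sum>i\<le>card B. monom (h i) i)"
  have c: "coeff P i = (if i \<le> card B then h i else 0)" for i
    unfolding P_def by (simp add: coeff_sum if_distrib sum.delta cong: if_cong)
  have "poly P f = 0" using h(3) unfolding P_def by (simp add: poly_sum poly_monom)
  moreover have "P \<noteq> 0" using h(2) c by (metis coeff_0)
  ultimately show "\<exists>P. P \<noteq> 0 \<and> (\<forall>i. coeff P i \<in> F) \<and> poly P f = 0"
    using c h(1) subfield_setD(1)[OF F] by (intro exI[of _ P]) auto
qed

context valuation_subring
begin

lemma inverse_not_unit: "r \<in> A - nonunits \<Longrightarrow> inverse r \<notin> nonunits"
  using unit_inverse by blast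

text \<open>
The values of the \<open>g i\<close> descend strictly and differ by less than the value of \<open>z\<close>.  As the values of
\<open>k(z)\<close> are the multiples of that of \<open>z\<close>, the \<open>g i\<close> lie in different classes of values modulo those of
\<open>k(z)\<close> and are linearly independent over \<open>k(z)\<close>, so that their number is bounded by the degree of the
extension.
\<close>

lemma chain_bound:
  assumes z: "z \<in> nonunits" "z \<noteq> 0" and fin: "finite_ext_of (ratfuns emb z)"
  shows "\<exists>m::nat. \<nexists>g. (\<forall>i. g i \<noteq> 0) \<and>
    (\<forall>i k. i < k \<longrightarrow> k \<le> m \<longrightarrow> g i / g k \<in> nonunits \<and> z * g k / g i \<in> nonunits)"
proof -
  let ?F = "ratfuns emb z"
  obtain B where B: "finite B" "\<And>f. \<exists>a. (\<forall>b\<in>B. a b \<in> ?F) \<and> f = (\<Sum>b\<in>B. a b * b)"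
    using fin unfolding finite_ext_of_def by blast
  have False
    if g: "\<And>i. g i \<noteq> 0" "\<And>i k. i < k \<Longrightarrow> k \<le> card B \<Longrightarrow> g i / g k \<in> nonunits \<and> z * g k / g i \<in> nonunits" for g
  proof -
    obtain h where h: "\<forall>i\<le>card B. h i \<in> ?F" "\<exists>i\<le>card B. h i \<noteq> 0" "(\<Sum>i\<le>card B. h i * g i) = 0"
      using dependent_if_card_gt[OF subfield_set_ratfuns[of z] B(1), where I = "{..card B}" and g = g] B(2) by auto
    define J where "J = {i. i \<le> card B \<and> h i \<noteq> 0}"
    have lt: "(h i * g i) / (h k * g k) \<notin> A - nonunits" if ik: "i \<in> J" "k \<in> J" "i < k" for i k
    proof
      let ?r = "(h i * g i) / (h k * g k)"
      assume r: "?r \<in> A - nonunits"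
      have "h i / h k \<in> ?F" "h i / h k \<noteq> 0"
        using h(1) ik subfield_setD(6)[OF subfield_set_ratfuns] unfolding J_def by auto
      then obtain j p q where pq: "h i / h k = z powi j * (ev p z / ev q z)" "poly p 0 \<noteq> 0" "poly q 0 \<noteq> 0"
        using ratfuns_unit_form[OF z] by blast
      define u where "u = ev p z / ev q z"
      have u: "u \<in> A - nonunits" unfolding u_def using ratio_unit[OF z(1) pq(2,3)] .
      have r_eq: "?r = z powi j * u * (g i / g k)"
        using pq(1) unfolding u_def by (metis times_divide_times_eq)
      consider n where "j = int n" | n where "j = - int (Suc n)"
        by (metis int_cases)
      then show False
      proof cases
        case 1
        have "z ^ n * u * (g i / g k) \<in> nonunits"
          using g(2)[OF ik(3)] ik(2) u unfolding J_def
          by (intro nonunits_mult[OF mult_in[OF power_in[OF nonunits_in[OF z(1)]]]]) auto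
        then show False using r r_eq 1 by simp
      next
        case 2
        have "inverse ?r = z ^ n * inverse u * (z * g k / g i)"
          unfolding r_eq 2 power_int_minus power_int_of_nat using g(1) z(2) by (simp add: field_simps)
        also have "\<dots> \<in> nonunits"
          using g(2)[OF ik(3)] ik(2) inverse_unit[OF u] unfolding J_def
          by (intro nonunits_mult[OF mult_in[OF power_in[OF nonunits_in[OF z(1)]]]]) auto
        finally show False using inverse_not_unit[OF r] by blast
      qed
    qed
    have "(\<Sum>i\<in>J. h i * g i) \<noteq> 0"
    proof (rule sum_nonzero)
      show "finite J" "J \<noteq> {}" using h(2) unfolding J_def by auto
      show "h i * g i \<noteq> 0" if "i \<in> J" for i using that g(1) unfolding J_def by auto
      fix i k assume ik: "i \<in> J" "k \<in> J" "i \<noteq> k"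
      show "(h i * g i) / (h k * g k) \<notin> A - nonunits"
      proof (cases "i < k")
        case True
        then show ?thesis using lt ik by blast
      next
        case False
        then have "(h k * g k) / (h i * g i) \<notin> A - nonunits" using lt[of k i] ik by simp
        then show ?thesis using inverse_unit[of "(h i * g i) / (h k * g k)"] by (simp only: inverse_divide) blast
      qed
    qed
    moreover have "(\<Sum>i\<in>J. h i * g i) = (\<Sum>i\<le>card B. h i * g i)"
      unfolding J_def by (intro sum.mono_neutral_left) auto
    ultimately show False using h(3) by simp
  qed
  then show ?thesis by (intro exI[of _ "card B"]) blast
qed

text \<open>
Without a generator of the maximal ideal one could descend from \<open>z\<close> indefinitely and violate
\<open>chain_bound\<close>.
\<close>

lemma ex_uniformizer:
  assumes z: "z \<in> nonunits" "z \<noteq> 0" and fin: "finite_ext_of (ratfuns emb z)"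
  shows "\<exists>\<pi>. \<pi> \<in> nonunits \<and> \<pi> \<noteq> 0 \<and> (\<forall>a\<in>nonunits. a / \<pi> \<in> A)"
proof (rule ccontr)
  assume no: "\<not> ?thesis"
  have "\<exists>a. a \<in> nonunits \<and> a \<noteq> 0 \<and> \<pi> / a \<in> nonunits" if pi: "\<pi> \<in> nonunits" "\<pi> \<noteq> 0" for \<pi>
  proof -
    obtain a where "a \<in> nonunits" "a / \<pi> \<notin> A" using no pi by blast
    then show ?thesis using not_in_iff[of "a / \<pi>"] by auto
  qed
  then obtain nx where nx: "\<And>p. p \<in> nonunits \<Longrightarrow> p \<noteq> 0 \<Longrightarrow> nx p \<in> nonunits \<and> nx p \<noteq> 0 \<and> p / nx p \<in> nonunits"
    by metis
  define g where "g n = (nx ^^ Suc n) z" for n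
  have g: "g n \<in> nonunits \<and> g n \<noteq> 0" for n
    unfolding g_def by (induct n) (use nx z in auto)
  have gz: "z / g n \<in> nonunits" for n
  proof (induct n)
    case 0
    then show ?case using nx[OF z] unfolding g_def by simp
  next
    case (Suc n)
    have "(z / g n) * (g n / g (Suc n)) \<in> nonunits"
      using nx[of "g n"] g[of n] nonunits_in[OF Suc] by (intro nonunits_mult) (auto simp: g_def)
    then show ?case using g[of n] by simp
  qed
  have gg: "g i / g k \<in> nonunits" if "i < k" for i k
    using that
  proof (induct k)
    case (Suc k)
    have k: "g k / g (Suc k) \<in> nonunits" using nx[of "g k"] g[of k] by (auto simp: g_def)
    show ?case
    proof (cases "i = k")
      case False
      then have "(g i / g k) * (g k / g (Suc k)) \<in> nonunits"
        using Suc nonunits_in k by (intro nonunits_mult) auto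
      then show ?thesis using g[of k] by simp
    qed (use k in simp)
  qed simp
  have "z * g k / g i \<in> nonunits" for i k
    using nonunits_mult[of "z / g i" "g k"] gz nonunits_in g by simp
  then show False using chain_bound[OF assms] g gg by blast
qed

text \<open>
The functions whose poles are cancelled by a power of \<open>z\<close> form a valuation ring that contains the
field \<open>k(z)\<close>, hence everything.
\<close>

lemma ex_power_mult_in:
  assumes z: "z \<in> nonunits" "z \<noteq> 0" and alg: "algebraic_over (ratfuns emb z)"
  shows "\<exists>n. z ^ n * f \<in> A"
proof -
  let ?A = "{f. \<exists>n. z ^ n * f \<in> A}"
  have zA: "z \<in> A" using z nonunits_in by blast
  have sub: "A \<subseteq> ?A"
  proof
    fix a assume "a \<in> A"
    then have "z ^ 0 * a \<in> A" by simp
    then show "a \<in> ?A" by blast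
  qed
  interpret A': valuation_subring emb ?A
  proof unfold_locales
    show "emb c \<in> ?A" for c using sub emb_in by blast
    show "u \<in> ?A \<or> inverse u \<in> ?A" for u using sub total[of u] by blast
    fix a b assume "a \<in> ?A" "b \<in> ?A"
    then obtain m n where mn: "z ^ m * a \<in> A" "z ^ n * b \<in> A" by blast
    have "z ^ n * (z ^ m * a) + z ^ m * (z ^ n * b) \<in> A" "(z ^ m * a) * (z ^ n * b) \<in> A"
      using mn zA by (auto intro!: add_in mult_in power_in)
    then have "z ^ (m + n) * (a + b) \<in> A" "z ^ (m + n) * (a * b) \<in> A"
      by (simp_all add: power_add algebra_simps)
    then show "a + b \<in> ?A" "a * b \<in> ?A" by blast+
  qed
  have "ratfuns emb z \<subseteq> ?A"
  proof
    fix h assume h: "h \<in> ratfuns emb z"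
    show "h \<in> ?A"
    proof (cases "h = 0")
      case True
      then show ?thesis using A'.zero_in by simp
    next
      case False
      then obtain j p q where pq: "h = z powi j * (ev p z / ev q z)" "poly p 0 \<noteq> 0" "poly q 0 \<noteq> 0"
        using ratfuns_unit_form[OF z h] by blast
      have u: "ev p z / ev q z \<in> A" using ratio_unit[OF z(1) pq(2,3)] by blast
      have "z ^ nat (- j) * h = z ^ nat j * (ev p z / ev q z)"
        unfolding pq(1) using z(2) by (cases "j \<ge> 0") (auto simp: power_int_def field_simps)
      then show ?thesis using mult_in[OF power_in[OF zA] u] by (metis (mono_tags, lifting) mem_Collect_eq)
    qed
  qed
  then have "?A = UNIV" using A'.eq_UNIV_if_algebraic[OF subfield_set_ratfuns _ alg] by blast
  then show ?thesis by blast
qed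

lemma powi_nonunit: "\<pi> \<in> nonunits \<Longrightarrow> 0 < (m::int) \<Longrightarrow> \<pi> powi m \<in> nonunits"
  using nonunits_power[of \<pi> "nat m"] by (simp add: power_int_def)

lemma powi_in: "\<pi> \<in> nonunits \<Longrightarrow> 0 \<le> (m::int) \<Longrightarrow> \<pi> powi m \<in> A"
  using power_in[OF nonunits_in, of \<pi> "nat m"] by (simp add: power_int_def)

text \<open>
A regular \<open>f\<close> is divisible by only finitely many powers of \<open>\<pi>\<close>: some power of \<open>z\<close> is a multiple of \<open>f\<close>
by \<open>ex_power_mult_in\<close>, and \<open>z\<close> itself is divisible by only finitely many powers by \<open>chain_bound\<close>.
\<close>

lemma ex_uniformizer_power:
  assumes z: "z \<in> nonunits" "z \<noteq> 0" and fin: "finite_ext_of (ratfuns emb z)"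
    and pi: "\<pi> \<in> nonunits" "\<pi> \<noteq> 0" "\<And>a. a \<in> nonunits \<Longrightarrow> a / \<pi> \<in> A" and "f \<noteq> 0"
  shows "\<exists>j. f / \<pi> powi j \<in> A - nonunits"
proof -
  have alg: "algebraic_over (ratfuns emb z)" by (rule algebraic_over_if_finite_ext[OF subfield_set_ratfuns fin])
  have "\<exists>n. z / \<pi> ^ n \<notin> nonunits"
  proof (rule ccontr)
    assume "\<not> ?thesis"
    then have all: "z / \<pi> ^ n \<in> nonunits" for n by blast
    have eq: "inverse \<pi> ^ i / inverse \<pi> ^ k = \<pi> ^ (k - i)" "z * inverse \<pi> ^ k / inverse \<pi> ^ i = z / \<pi> ^ (k - i)"
      if "i < k" for i k
      using that pi(2) by (simp_all add: power_diff field_simps)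
    have "inverse \<pi> ^ i / inverse \<pi> ^ k \<in> nonunits \<and> z * inverse \<pi> ^ k / inverse \<pi> ^ i \<in> nonunits" if "i < k" for i k
      unfolding eq[OF that] using all nonunits_power[OF pi(1)] that by simp
    moreover have "\<forall>i. inverse \<pi> ^ i \<noteq> 0" using pi(2) by simp
    ultimately show False using chain_bound[OF assms(1-3)] by blast
  qed
  then obtain n where n: "\<pi> ^ n / z \<in> A"
    by (metis inverse_divide nonunits_in not_in_iff unit_inverse)
  have ex: "\<exists>j. f / \<pi> powi j \<in> A - nonunits" if f: "f \<noteq> 0" "f \<in> A" for f
  proof -
    obtain N where N: "z ^ N * inverse f \<in> A" using ex_power_mult_in[OF z alg] by blast
    have "\<exists>k. f / \<pi> ^ k \<notin> A"
    proof (rule ccontr)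
      assume "\<not> ?thesis"
      then have "f / \<pi> ^ (n * N + 1) \<in> A" by blast
      then have "(f / \<pi> ^ (n * N + 1)) * (z ^ N * inverse f) * (\<pi> ^ n / z) ^ N \<in> A"
        by (rule mult_in[OF mult_in[OF _ N] power_in[OF n]])
      also have "(f / \<pi> ^ (n * N + 1)) * (z ^ N * inverse f) * (\<pi> ^ n / z) ^ N = inverse \<pi>"
        using f(1) z(2) pi(2) unfolding power_add power_mult by (simp add: field_simps)
      finally show False using pi(1,2) unfolding nonunits_def by simp
    qed
    from exists_least_iff[THEN iffD1, OF this]
    obtain k where k: "f / \<pi> ^ k \<notin> A" "\<And>i. i < k \<Longrightarrow> f / \<pi> ^ i \<in> A" by auto
    have "k \<noteq> 0" using k(1) f(2) by (metis div_by_1 power_0)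
    then obtain i where i: "k = Suc i" by (metis not0_implies_Suc)
    have "f / \<pi> ^ i \<notin> nonunits"
      using pi(3)[of "f / \<pi> ^ i"] k(1) unfolding i by (auto simp: field_simps)
    then show ?thesis using k(2)[of i] i by (intro exI[of _ "int i"]) auto
  qed
  show ?thesis
  proof (cases "f \<in> A")
    case True
    then show ?thesis using ex \<open>f \<noteq> 0\<close> by blast
  next
    case False
    then have "inverse f \<in> A" using total by blast
    then obtain j where "inverse f / \<pi> powi j \<in> A - nonunits" using ex[of "inverse f"] \<open>f \<noteq> 0\<close> by auto
    moreover have "inverse (inverse f / \<pi> powi j) = f / \<pi> powi (- j)"
      using pi(2) by (simp add: power_int_minus field_simps)
    ultimately show ?thesis using inverse_unit by metis
  qed
qed

text \<open>
Every proper valuation ring over the constants is the ring of functions regular at a point: the order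
of \<open>f\<close> is the exponent of the uniformizer in \<open>f\<close>.
\<close>

lemma ex_point:
  assumes "A \<noteq> UNIV" and fin: "finite_ext_of (ratfuns emb t)"
  shows "\<exists>\<eta>\<in>points emb. \<forall>f. regular_at \<eta> f \<longleftrightarrow> f \<in> A"
proof -
  obtain z where z: "z \<in> nonunits" "z \<noteq> 0" "ratfuns emb t \<subseteq> ratfuns emb z"
    using ex_nonunit_coordinate[OF assms(1) algebraic_over_if_finite_ext[OF subfield_set_ratfuns fin]] by blast
  have finz: "finite_ext_of (ratfuns emb z)"
    using fin z(3) unfolding finite_ext_of_def by (meson subsetD)
  obtain \<pi> where pi: "\<pi> \<in> nonunits" "\<pi> \<noteq> 0" "\<And>a. a \<in> nonunits \<Longrightarrow> a / \<pi> \<in> A"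
    using ex_uniformizer[OF z(1,2) finz] by blast
  define v where "v f = (if f = 0 then 0 else SOME j. f / \<pi> powi j \<in> A - nonunits)" for f
  have v: "f / \<pi> powi v f \<in> A - nonunits" if "f \<noteq> 0" for f
    using someI_ex[OF ex_uniformizer_power[OF z(1,2) finz pi that]] that unfolding v_def by simp
  have split: "f / \<pi> powi m = (f / \<pi> powi n) * \<pi> powi (n - m)" for f m n
    using pi(2) by (simp add: power_int_diff)
  have ge_iff: "f / \<pi> powi m \<in> A \<longleftrightarrow> m \<le> v f" if f: "f \<noteq> 0" for f m
  proof
    assume m: "f / \<pi> powi m \<in> A"
    show "m \<le> v f"
    proof (rule ccontr)
      assume "\<not> m \<le> v f"
      then have "f / \<pi> powi v f \<in> nonunits"
        unfolding split[of f "v f" m] by (intro nonunits_mult[OF m] powi_nonunit pi(1)) simp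
      then show False using v[OF f] by blast
    qed
  next
    assume "m \<le> v f"
    then show "f / \<pi> powi m \<in> A"
      unfolding split[of f m "v f"] using v[OF f] by (intro mult_in powi_in pi(1)) auto
  qed
  have unique: "v f = m" if m: "f / \<pi> powi m \<in> A - nonunits" for f m
  proof -
    have f: "f \<noteq> 0" using m zero_nonunit by auto
    have "\<not> m < v f"
    proof
      assume "m < v f"
      then have "f / \<pi> powi m \<in> nonunits"
        unfolding split[of f m "v f"] using v[OF f] by (intro nonunits_mult powi_nonunit pi(1)) auto
      then show False using m by blast
    qed
    then show ?thesis using ge_iff[OF f] m by force
  qed
  have "v \<in> points emb"
    unfolding points_def
  proof (intro CollectI conjI allI impI)
    show "v 0 = 0" by (simp add: v_def)
    show "v (emb c) = 0" if "c \<noteq> 0" for c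
      using that emb_in emb_nonunit by (intro unique) auto
    show "v (f * g) = v f + v g" if "f \<noteq> 0" "g \<noteq> 0" for f g
      using mult_unit[OF v[OF that(1)] v[OF that(2)]] pi(2)
      by (intro unique) (simp add: power_int_add)
    show "min (v f) (v g) \<le> v (f + g)" if "f \<noteq> 0" "g \<noteq> 0" "f + g \<noteq> 0" for f g
    proof -
      have "f / \<pi> powi min (v f) (v g) \<in> A" "g / \<pi> powi min (v f) (v g) \<in> A"
        using that by (simp_all add: ge_iff)
      then have "(f + g) / \<pi> powi min (v f) (v g) \<in> A"
        using add_in by (simp add: add_divide_distrib)
      then show ?thesis using ge_iff[OF that(3)] by blast
    qed
    show "\<exists>f. f \<noteq> 0 \<and> v f = 1"
      using pi(2) one_in one_not_nonunit by (intro exI[of _ \<pi>] conjI unique) auto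
  qed
  moreover have "regular_at v f \<longleftrightarrow> f \<in> A" for f
    unfolding regular_at_def using ge_iff[of f 0] zero_in by auto
  ultimately show ?thesis by blast
qed

end

section \<open>Existence of points\<close>

definition subalgebra :: "('k \<Rightarrow> 'f::field) \<Rightarrow> 'f set \<Rightarrow> bool" where
  "subalgebra emb A \<longleftrightarrow> range emb \<subseteq> A \<and> (\<forall>a\<in>A. \<forall>b\<in>A. a + b \<in> A \<and> a * b \<in> A)"

context constant_embedding
begin

lemma subalgebra_minus:
  assumes "subalgebra emb A" "a \<in> A" "b \<in> A"
  shows "a - b \<in> A"
proof -
  have "emb (- 1) \<in> A" using assms(1) unfolding subalgebra_def by blast
  then have "a + emb (- 1) * b \<in> A" using assms unfolding subalgebra_def by blast
  then show ?thesis by (simp add: emb_simps)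
qed

lemma subalgebra_Union:
  assumes "\<C> \<noteq> {}" "subset.chain \<A> \<C>" "\<And>A. A \<in> \<C> \<Longrightarrow> subalgebra emb A"
  shows "subalgebra emb (\<Union>\<C>)"
  unfolding subalgebra_def
proof (intro conjI ballI)
  show "range emb \<subseteq> \<Union>\<C>" using assms(1,3) unfolding subalgebra_def by blast
  fix a b assume "a \<in> \<Union>\<C>" "b \<in> \<Union>\<C>"
  then obtain A B where "A \<in> \<C>" "B \<in> \<C>" "a \<in> A" "b \<in> B" by blast
  moreover have "A \<subseteq> B \<or> B \<subseteq> A" using assms(2) \<open>A \<in> \<C>\<close> \<open>B \<in> \<C>\<close> unfolding subset.chain_def by blast
  ultimately obtain C where "C \<in> \<C>" "a \<in> C" "b \<in> C" by blast
  then show "a + b \<in> \<Union>\<C>" "a * b \<in> \<Union>\<C>" using assms(3) unfolding subalgebra_def by blast+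
qed

lemma subalgebra_adjoin:
  assumes "subalgebra emb A"
  shows "subalgebra emb {poly P u | P. \<forall>i. coeff P i \<in> A}" (is "subalgebra emb ?B")
proof -
  have 0: "0 \<in> A" using assms subalgebra_minus[OF assms, of "emb 0" "emb 0"] unfolding subalgebra_def by auto
  have sum: "sum a I \<in> A" if "\<And>i. i \<in> I \<Longrightarrow> a i \<in> A" for a :: "nat \<Rightarrow> 'f" and I
    using that assms 0 unfolding subalgebra_def
    by (induct I rule: infinite_finite_induct) auto
  show ?thesis
    unfolding subalgebra_def
  proof (intro conjI ballI subsetI)
    fix a assume "a \<in> range emb"
    then show "a \<in> ?B" using assms 0 unfolding subalgebra_def
      by (intro CollectI exI[of _ "[:a:]"]) (auto simp: coeff_pCons split: nat.splits)
  next
    fix a b assume "a \<in> ?B" "b \<in> ?B"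
    then obtain P Q where PQ: "a = poly P u" "b = poly Q u" "\<forall>i. coeff P i \<in> A" "\<forall>i. coeff Q i \<in> A" by blast
    have "\<forall>i. coeff (P + Q) i \<in> A" using PQ assms unfolding subalgebra_def by auto
    then show "a + b \<in> ?B" using PQ by (intro CollectI exI[of _ "P + Q"]) auto
    have "\<forall>i. coeff (P * Q) i \<in> A"
      using PQ assms unfolding subalgebra_def coeff_mult by (intro allI sum) auto
    then show "a * b \<in> ?B" using PQ by (intro CollectI exI[of _ "P * Q"]) auto
  qed
qed

text \<open>
The heart of the extension theorem for valuations: \<open>u\<close> and \<open>1/u\<close> cannot both satisfy a relation that
expresses \<open>1\<close> as a polynomial with coefficients in a proper ideal \<open>I\<close> of \<open>A\<close>.  The relation of lower
degree is used to lower the degree of the other one without leaving the ideal.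
\<close>

lemma no_relation_on_both_sides:
  assumes A: "subalgebra emb A" and I: "I \<subseteq> A" "1 \<notin> I"
    "\<And>a b. a \<in> I \<Longrightarrow> b \<in> I \<Longrightarrow> a + b \<in> I" "\<And>r a. r \<in> A \<Longrightarrow> a \<in> I \<Longrightarrow> r * a \<in> I"
    and "u \<noteq> 0"
    and "\<forall>i. coeff Q i \<in> I" "poly Q u = 1" "\<forall>i. coeff R i \<in> I" "poly R (inverse u) = 1"
  shows False
  using assms(6-)
proof (induct "degree Q + degree R" arbitrary: u Q R rule: less_induct)
  case less
  have 1: "1 \<in> A" using A emb.hom_one unfolding subalgebra_def by (metis rangeI subsetD)
  have 0: "0 \<in> I" using less.prems(2)[rule_format, of "Suc (degree Q)"] by (simp add: coeff_eq_0)
  have diff: "a - b \<in> I" if "a \<in> I" "b \<in> I" for a b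
  proof -
    have "0 - 1 \<in> A" by (rule subalgebra_minus[OF A _ 1]) (use 0 I in blast)
    then have "a + (0 - 1) * b \<in> I" using that I by blast
    then show ?thesis by simp
  qed
  have step: False
    if sm: "\<And>Q' R'. degree Q' + degree R' < degree Q + degree R \<Longrightarrow> \<forall>i. coeff Q' i \<in> I \<Longrightarrow> poly Q' u = 1 \<Longrightarrow>
         \<forall>i. coeff R' i \<in> I \<Longrightarrow> poly R' (inverse u) = 1 \<Longrightarrow> False"
      and u: "u \<noteq> 0" and Q: "\<forall>i. coeff Q i \<in> I" "poly Q u = 1" and R: "\<forall>i. coeff R i \<in> I" "poly R (inverse u) = 1"
      and le: "degree R \<le> degree Q" for u Q R
  proof -
    let ?n = "degree Q" and ?c = "coeff R 0" and ?b = "lead_coeff Q"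
    have n: "0 < ?n"
    proof (rule ccontr)
      assume "\<not> 0 < ?n"
      then obtain b where "Q = [:b:]" by (metis degree_eq_zeroE neq0_conv)
      then show False using Q(1)[rule_format, of 0] Q(2) I(2) by simp
    qed
    \<comment> \<open>\<open>T\<close> is \<open>X ^ ?n * R(1/X)\<close>, with constant coefficient of \<open>R\<close> in degree \<open>?n\<close>.\<close>
    define T where "T = (\<Sum>i\<le>?n. monom (coeff R (?n - i)) i)"
    have cT: "coeff T i = (if i \<le> ?n then coeff R (?n - i) else 0)" for i
      unfolding T_def by (simp add: coeff_sum if_distrib sum.delta cong: if_cong)
    have "poly T u = (\<Sum>i\<le>?n. coeff R (?n - i) * u ^ i)"
      unfolding T_def by (simp add: poly_sum poly_monom)
    also have "\<dots> = (\<Sum>i\<le>?n. coeff R i * u ^ (?n - i))"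
      by (rule sum.reindex_bij_witness[of _ "\<lambda>i. ?n - i" "\<lambda>i. ?n - i"]) auto
    also have "\<dots> = (\<Sum>i\<le>?n. u ^ ?n * (coeff R i * inverse u ^ i))"
      using u by (intro sum.cong) (auto simp: power_diff field_simps)
    also have "\<dots> = u ^ ?n * poly R (inverse u)"
    proof -
      have "poly R (inverse u) = (\<Sum>i\<le>?n. coeff R i * inverse u ^ i)"
        unfolding poly_altdef using le by (intro sum.mono_neutral_left) (auto simp: coeff_eq_0)
      then show ?thesis by (simp add: sum_distrib_left)
    qed
    finally have T: "poly T u = u ^ ?n" using R(2) by simp
    \<comment> \<open>At \<open>u\<close> the polynomials \<open>Q\<close> and \<open>T\<close> have the values \<open>1\<close> and \<open>u ^ ?n\<close>, so \<open>Q'\<close> has the value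
      \<open>?c + (1 - ?c) = 1\<close>, while its terms of degree \<open>?n\<close> have been removed.\<close>
    define Q' where "Q' = [:?c:] + smult (1 - ?c) (Q - monom ?b ?n) + smult ?b (T - monom ?c ?n)"
    have "poly Q' u = 1"
      unfolding Q'_def by (simp add: poly_monom T Q(2) algebra_simps)
    moreover have "\<forall>i. coeff Q' i \<in> I"
    proof
      fix i
      have A1: "1 - ?c \<in> A" by (rule subalgebra_minus[OF A 1]) (use R I in blast)
      have "coeff [:?c:] i \<in> I" "coeff (monom ?b ?n) i \<in> I" "coeff (monom ?c ?n) i \<in> I" "coeff T i \<in> I"
        using R(1) Q(1) 0 by (auto simp: cT coeff_pCons split: nat.splits)
      then show "coeff Q' i \<in> I"
        using A1 Q(1) R(1) I(1) unfolding Q'_def coeff_add coeff_smult coeff_diff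
        by (intro I(3) I(4) diff) auto
    qed
    moreover have "degree Q' < degree Q"
    proof -
      have "coeff Q' i = 0" if "?n - 1 < i" for i
      proof (cases "i = ?n")
        case True
        then show ?thesis using n unfolding Q'_def by (simp add: cT coeff_pCons split: nat.splits)
      next
        case False
        then have "?n < i" using that by simp
        then show ?thesis unfolding Q'_def by (simp add: cT coeff_pCons coeff_eq_0 split: nat.splits)
      qed
      then have "degree Q' \<le> ?n - 1" by (intro degree_le) auto
      then show ?thesis using n by simp
    qed
    ultimately show False using sm[of Q' R] R by simp
  qed
  show False
  proof (cases "degree R \<le> degree Q")
    case True
    then show ?thesis using step[of Q R u] less by blast
  next
    case False
    then have *: "degree Q \<le> degree R" by simp
    show ?thesis
    proof (rule step[of R Q "inverse u"])
      fix Q' R' assume "degree Q' + degree R' < degree R + degree Q" "\<forall>i. coeff Q' i \<in> I"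
        "poly Q' (inverse u) = 1" "\<forall>i. coeff R' i \<in> I" "poly R' (inverse (inverse u)) = 1"
      then show False using less.hyps[of R' Q' u] less.prems(1) by (simp add: add.commute)
    qed (use less.prems * in auto)
  qed
qed

text \<open>
A subalgebra that is maximal among those containing \<open>w\<close> but not \<open>1/w\<close> is a valuation ring: if it
contained neither \<open>u\<close> nor \<open>1/u\<close>, adjoining either of them would produce \<open>1/w\<close>, which gives two
relations with coefficients in the ideal generated by \<open>w\<close>.
\<close>

lemma ex_valuation_subring:
  assumes w: "transcendental_over emb w"
  shows "\<exists>A. valuation_subring emb A \<and> inverse w \<notin> A"
proof -
  have "ev [:0, 1:] w \<noteq> 0" using w unfolding transcendental_over_def by (metis one_neq_zero pCons_eq_0_iff)
  then have w0: "w \<noteq> 0" by simp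
  define \<A> where "\<A> = {A. subalgebra emb A \<and> w \<in> A \<and> inverse w \<notin> A}"
  have "range (\<lambda>p. ev p w) \<in> \<A>"
  proof -
    have "ev [:0, 1:] w = w" by simp
    then have "w \<in> range (\<lambda>p. ev p w)" by (metis rangeI)
    moreover have "emb c \<in> range (\<lambda>p. ev p w)" for c
      by (rule range_eqI[of _ _ "[:c:]"]) simp
    then have "subalgebra emb (range (\<lambda>p. ev p w))"
      unfolding subalgebra_def by (auto simp flip: ev_simps(5,7))
    moreover have "inverse w \<noteq> ev p w" for p
    proof
      assume "inverse w = ev p w"
      then have "ev (pCons (- 1) p) w = 0" using w0 by (simp add: emb_simps flip: \<open>inverse w = ev p w\<close>)
      then show False using w unfolding transcendental_over_def
        by (metis neg_equal_0_iff_equal pCons_eq_0_iff zero_neq_one)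
    qed
    ultimately show ?thesis unfolding \<A>_def by auto
  qed
  then have "\<A> \<noteq> {}" by blast
  moreover have "\<Union>\<C> \<in> \<A>" if "\<C> \<noteq> {}" "subset.chain \<A> \<C>" for \<C>
    using subalgebra_Union[OF that] that unfolding \<A>_def subset.chain_def by blast
  ultimately have "\<exists>M\<in>\<A>. \<forall>X\<in>\<A>. M \<subseteq> X \<longrightarrow> X = M" by (rule subset_Zorn_nonempty)
  then obtain A where A: "A \<in> \<A>" and max: "\<And>X. X \<in> \<A> \<Longrightarrow> A \<subseteq> X \<Longrightarrow> X = A" by blast
  have alg: "subalgebra emb A" and wA: "w \<in> A" and nA: "inverse w \<notin> A" using A unfolding \<A>_def by auto
  define I where "I = {a. inverse w * a \<in> A}"
  have I: "I \<subseteq> A" "1 \<notin> I" "\<And>a b. a \<in> I \<Longrightarrow> b \<in> I \<Longrightarrow> a + b \<in> I" "\<And>r a. r \<in> A \<Longrightarrow> a \<in> I \<Longrightarrow> r * a \<in> I"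
  proof -
    show "I \<subseteq> A"
    proof
      fix a assume "a \<in> I"
      then have "w * (inverse w * a) \<in> A" using alg wA unfolding I_def subalgebra_def by blast
      then show "a \<in> A" using w0 by (simp flip: mult.assoc)
    qed
    show "1 \<notin> I" using nA unfolding I_def by simp
    show "a + b \<in> I" if "a \<in> I" "b \<in> I" for a b
      using that alg unfolding I_def subalgebra_def by (simp add: distrib_left)
    show "r * a \<in> I" if "r \<in> A" "a \<in> I" for r a
      using that alg unfolding I_def subalgebra_def by (simp add: mult.left_commute)
  qed
  have relation: "\<exists>Q. (\<forall>i. coeff Q i \<in> I) \<and> poly Q u = 1" if u: "u \<notin> A" for u
  proof -
    let ?B = "{poly P u | P. \<forall>i. coeff P i \<in> A}"
    have 01: "0 \<in> A" "1 \<in> A" using alg emb.hom_zero emb.hom_one unfolding subalgebra_def by (metis rangeI subsetD)+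
    have "u \<in> ?B"
      using 01 by (intro CollectI exI[of _ "[:0, 1:]"]) (auto simp: coeff_pCons split: nat.splits)
    moreover have "A \<subseteq> ?B"
    proof
      fix a assume "a \<in> A"
      then show "a \<in> ?B"
        using 01 by (intro CollectI exI[of _ "[:a:]"]) (auto simp: coeff_pCons split: nat.splits)
    qed
    ultimately have "?B \<notin> \<A>" using max[of ?B] u by blast
    then have "inverse w \<in> ?B" using subalgebra_adjoin[OF alg, of u] \<open>A \<subseteq> ?B\<close> wA unfolding \<A>_def by blast
    then obtain P where P: "inverse w = poly P u" "\<forall>i. coeff P i \<in> A" by blast
    then have "poly (smult w P) u = 1" "\<forall>i. coeff (smult w P) i \<in> I"
      using w0 unfolding I_def by (simp_all flip: P(1) mult.assoc)
    then show ?thesis by blast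
  qed
  have "valuation_subring emb A"
  proof unfold_locales
    show "u \<in> A \<or> inverse u \<in> A" for u
    proof (rule ccontr)
      assume no: "\<not> ?thesis"
      moreover have "u \<noteq> 0"
        using no alg emb.hom_zero unfolding subalgebra_def by (metis rangeI subsetD)
      ultimately show False
        using relation[of u] relation[of "inverse u"] no_relation_on_both_sides[OF alg I] by blast
    qed
  qed (use alg in \<open>auto simp: subalgebra_def\<close>)
  then show ?thesis using nA by blast
qed

end

text \<open>
Nonconstant functions have poles: a valuation ring without \<open>e\<close>, supplied by \<open>ex_valuation_subring\<close> for
\<open>w = 1/e\<close>, is the ring of a point, and there \<open>e\<close> is not regular.
\<close>

lemma ex_pole:
  assumes "function_field emb" and "transcendental_over emb (inverse e)"
  shows "\<exists>\<eta>\<in>points emb. \<eta> e < 0"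
proof -
  interpret constant_embedding emb
    using assms(1) unfolding function_field_def by (intro constant_embedding.intro) blast
  obtain t where t: "finite_ext_of (ratfuns emb t)"
    using assms(1) unfolding function_field_def by blast
  obtain A where A: "valuation_subring emb A" "e \<notin> A"
    using ex_valuation_subring[OF assms(2)] by auto
  interpret valuation_subring emb A by (fact A(1))
  have "A \<noteq> UNIV" using A(2) by blast
  from ex_point[OF this t] obtain \<eta> where "\<eta> \<in> points emb" "\<not> regular_at \<eta> e" using A(2) by blast
  then show ?thesis unfolding regular_at_def by force
qed

section \<open>Orders at a point\<close>

text \<open>
The passage from a point to its valuation ring, converse to \<open>ex_point\<close>.
\<close>

lemma valuation_subring_of_point:
  assumes "constant_embedding emb" "\<xi> \<in> points emb"
  shows "valuation_subring emb {f. zero_of_order_ge \<xi> f 0}"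
    and "valuation_subring.nonunits {f. zero_of_order_ge \<xi> f 0} = {f. zero_of_order_ge \<xi> f 1}"
    and "{f. zero_of_order_ge \<xi> f 0} \<noteq> UNIV"
proof -
  interpret constant_embedding emb by (fact assms(1))
  have mult: "\<xi> (f * g) = \<xi> f + \<xi> g" if "f \<noteq> 0" "g \<noteq> 0" for f g
    using assms(2) that unfolding points_def by blast
  have add: "min (\<xi> f) (\<xi> g) \<le> \<xi> (f + g)" if "f \<noteq> 0" "g \<noteq> 0" "f + g \<noteq> 0" for f g
    using assms(2) that unfolding points_def by blast
  have const: "\<xi> (emb c) = 0" for c
    using assms(2) unfolding points_def by (cases "c = 0") auto
  have inv: "\<xi> (inverse f) = - \<xi> f" if "f \<noteq> 0" for f
    using mult[OF that, of "inverse f"] const[of 1] that by simp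
  show vs: "valuation_subring emb {f. zero_of_order_ge \<xi> f 0}"
  proof unfold_locales
    fix a b assume ab: "a \<in> {f. zero_of_order_ge \<xi> f 0}" "b \<in> {f. zero_of_order_ge \<xi> f 0}"
    show "a * b \<in> {f. zero_of_order_ge \<xi> f 0}"
      using ab mult[of a b] unfolding zero_of_order_ge_def by (cases "a = 0"; cases "b = 0") auto
    show "a + b \<in> {f. zero_of_order_ge \<xi> f 0}"
      using ab add[of a b] unfolding zero_of_order_ge_def
      by (cases "a = 0"; cases "b = 0"; cases "a + b = 0") auto
  next
    show "emb c \<in> {f. zero_of_order_ge \<xi> f 0}" for c
      using const[of c] by (simp add: zero_of_order_ge_def)
    show "u \<in> {f. zero_of_order_ge \<xi> f 0} \<or> inverse u \<in> {f. zero_of_order_ge \<xi> f 0}" for u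
      using inv[of u] unfolding zero_of_order_ge_def by (cases "u = 0") auto
  qed
  show "valuation_subring.nonunits {f. zero_of_order_ge \<xi> f 0} = {f. zero_of_order_ge \<xi> f 1}"
    unfolding valuation_subring.nonunits_def[OF vs]
  proof (rule Set.set_eqI)
    fix a
    show "a \<in> {a \<in> {f. zero_of_order_ge \<xi> f 0}. a = 0 \<or> inverse a \<notin> {f. zero_of_order_ge \<xi> f 0}}
      \<longleftrightarrow> a \<in> {f. zero_of_order_ge \<xi> f 1}"
      using inv[of a] unfolding zero_of_order_ge_def by (cases "a = 0") auto
  qed
  obtain f where f: "f \<noteq> 0" "\<xi> f = 1" using assms(2) unfolding points_def by blast
  then have "inverse f \<notin> {f. zero_of_order_ge \<xi> f 0}" using inv by (auto simp: zero_of_order_ge_def)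
  then show "{f. zero_of_order_ge \<xi> f 0} \<noteq> UNIV" by blast
qed

locale function_field_point = constant_embedding emb
  for emb :: "'k::alg_closed_field \<Rightarrow> 'f::field" +
  fixes \<xi> :: "'f point"
  assumes point: "\<xi> \<in> points emb"
begin

lemma order_zero [simp]: "\<xi> 0 = 0" and order_const: "\<xi> (emb c) = 0"
  and order_mult: "f \<noteq> 0 \<Longrightarrow> g \<noteq> 0 \<Longrightarrow> \<xi> (f * g) = \<xi> f + \<xi> g"
  and order_add: "f \<noteq> 0 \<Longrightarrow> g \<noteq> 0 \<Longrightarrow> f + g \<noteq> 0 \<Longrightarrow> min (\<xi> f) (\<xi> g) \<le> \<xi> (f + g)"
  using point unfolding points_def by (auto, metis emb.hom_zero)

lemma order_one [simp]: "\<xi> 1 = 0"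
  using order_const[of 1] by (simp add: emb_simps)

lemma order_inverse: "f \<noteq> 0 \<Longrightarrow> \<xi> (inverse f) = - \<xi> f"
  using order_mult[of f "inverse f"] by simp

lemma order_divide: "f \<noteq> 0 \<Longrightarrow> g \<noteq> 0 \<Longrightarrow> \<xi> (f / g) = \<xi> f - \<xi> g"
  by (simp add: divide_inverse order_mult order_inverse)

lemma order_power: "f \<noteq> 0 \<Longrightarrow> \<xi> (f ^ n) = int n * \<xi> f"
  by (induct n) (simp_all add: order_mult algebra_simps)

lemma order_power_int: "f \<noteq> 0 \<Longrightarrow> \<xi> (f powi j) = j * \<xi> f"
  by (cases j rule: int_cases2) (simp_all add: order_power power_int_minus order_inverse)

abbreviation order_ge :: "'f \<Rightarrow> int \<Rightarrow> bool" where
  "order_ge \<equiv> zero_of_order_ge \<xi>"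

lemma order_ge_zero: "order_ge 0 m"
  by (simp add: zero_of_order_ge_def)

lemma order_ge_const: "order_ge (emb c) 0"
  by (simp add: zero_of_order_ge_def order_const)

lemma order_ge_mono: "order_ge f m \<Longrightarrow> n \<le> m \<Longrightarrow> order_ge f n"
  by (auto simp: zero_of_order_ge_def)

lemma order_ge_mult: "order_ge f m \<Longrightarrow> order_ge g n \<Longrightarrow> order_ge (f * g) (m + n)"
  by (cases "f = 0"; cases "g = 0") (auto simp: zero_of_order_ge_def order_mult)

lemma order_ge_add: "order_ge f m \<Longrightarrow> order_ge g m \<Longrightarrow> order_ge (f + g) m"
  using order_add[of f g]
  by (cases "f = 0"; cases "g = 0"; cases "f + g = 0") (auto simp: zero_of_order_ge_def)

lemma order_ge_sum: "(\<And>i. i \<in> I \<Longrightarrow> order_ge (a i) m) \<Longrightarrow> order_ge (sum a I) m"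
  by (induct I rule: infinite_finite_induct) (auto simp: order_ge_zero order_ge_add)

lemma order_ge_prod: "finite I \<Longrightarrow> (\<And>i. i \<in> I \<Longrightarrow> order_ge (a i) (w i)) \<Longrightarrow> order_ge (prod a I) (sum w I)"
  by (induct I rule: finite_induct) (auto simp: order_ge_mult, simp add: zero_of_order_ge_def)

text \<open>
Each term of the Leibniz formula takes one entry from each row, so its order is at least the sum of the
corresponding weights.
\<close>

lemma order_ge_det:
  assumes "B \<in> carrier_mat n n"
    and "\<And>i j. i < n \<Longrightarrow> j < n \<Longrightarrow> order_ge (B $$ (i, j)) (w i j)"
    and "\<And>p. p permutes {0..<n} \<Longrightarrow> m \<le> (\<Sum>i = 0..<n. w i (p i))"
  shows "order_ge (det B) m"
  unfolding det_def'[OF assms(1)]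
proof (rule order_ge_sum)
  fix p assume "p \<in> {p. p permutes {0..<n}}"
  then have p: "p permutes {0..<n}" by simp
  have "order_ge (\<Prod>i = 0..<n. B $$ (i, p i)) (\<Sum>i = 0..<n. w i (p i))"
    using assms(2) permutes_in_image[OF p] by (intro order_ge_prod) auto
  then have "order_ge (\<Prod>i = 0..<n. B $$ (i, p i)) m" using assms(3)[OF p] by (rule order_ge_mono)
  moreover have "order_ge (signof p) 0"
    using order_ge_const[of 1] order_ge_const[of "- 1"] by (auto simp: sign_def emb_simps)
  ultimately show "order_ge (signof p * (\<Prod>i = 0..<n. B $$ (i, p i))) m"
    using order_ge_mult[of "signof p" 0] by simp
qed

sublocale valuation_subring emb "{f. order_ge f 0}"
  by (rule valuation_subring_of_point(1)[OF constant_embedding_axioms point])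

lemma nonunits_eq: "nonunits = {f. order_ge f 1}"
  by (rule valuation_subring_of_point(2)[OF constant_embedding_axioms point])

lemma proper_subring: "{f. order_ge f 0} \<noteq> UNIV"
  by (rule valuation_subring_of_point(3)[OF constant_embedding_axioms point])

lemma unit_iff: "f \<in> {f. order_ge f 0} - nonunits \<longleftrightarrow> f \<noteq> 0 \<and> \<xi> f = 0"
  unfolding nonunits_eq by (auto simp: zero_of_order_ge_def)

end

section \<open>Hasse-Schmidt derivations and unramified points\<close>

lemma poly_taylor_two:
  fixes H :: "'a::idom poly"
  shows "\<exists>r. poly H (a + e) = poly H a + e * poly (pderiv H) a + e ^ 2 * r"
proof (induct H)
  case 0
  show ?case by (intro exI[of _ 0]) simp
next
  case (pCons c H)
  then obtain r where r: "poly H (a + e) = poly H a + e * poly (pderiv H) a + e ^ 2 * r" by blast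
  show ?case
    by (rule exI[of _ "poly (pderiv H) a + a * r + e * r"])
      (simp add: r pderiv_pCons algebra_simps power2_eq_square)
qed

text \<open>
The Taylor expansion of \<open>P(q + s Y)\<close> up to second order, with control of the coefficients of the
remainder.
\<close>

lemma pcompose_taylor_two:
  fixes P :: "'a::idom poly"
  assumes S: "0 \<in> S" "\<And>a b. a \<in> S \<Longrightarrow> b \<in> S \<Longrightarrow> a + b \<in> S" "\<And>a b. a \<in> S \<Longrightarrow> b \<in> S \<Longrightarrow> a * b \<in> S"
    and "\<And>i. coeff P i \<in> S" "q \<in> S" "s \<in> S"
  shows "\<exists>R. (\<forall>i. coeff R i \<in> S) \<and>
    P \<circ>\<^sub>p [:q, s:] = [:poly P q, s * poly (pderiv P) q:] + smult (s ^ 2) (pCons 0 (pCons 0 R))"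
  using assms(4)
proof (induct P)
  case 0
  show ?case by (intro exI[of _ 0]) (simp add: S(1))
next
  case (pCons c P)
  have cS: "c \<in> S" "\<And>i. coeff P i \<in> S" using pCons(3)[of 0] pCons(3)[of "Suc _"] by simp_all
  then obtain R where R: "\<forall>i. coeff R i \<in> S"
    "P \<circ>\<^sub>p [:q, s:] = [:poly P q, s * poly (pderiv P) q:] + smult (s ^ 2) (pCons 0 (pCons 0 R))"
    using pCons(2) by blast
  have P': "poly Q q \<in> S" if "\<And>i. coeff Q i \<in> S" for Q
    using that
  proof (induct Q)
    case (pCons d Q)
    have "d \<in> S" "poly Q q \<in> S" using pCons(2) pCons(3)[of 0] pCons(3)[of "Suc _"] by simp_all
    then show ?case using S assms(5) by simp
  qed (simp add: S(1))
  have of_nat: "of_nat n * b \<in> S" if "b \<in> S" for n b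
    by (induct n) (auto simp: S(1,2) that distrib_right)
  have d: "poly (pderiv P) q \<in> S"
    by (rule P') (auto simp: coeff_pderiv intro!: of_nat cS(2) simp del: of_nat_Suc)
  let ?R = "[:poly (pderiv P) q:] + smult q R + smult s (pCons 0 R)"
  have "coeff ?R i \<in> S" for i
    using d R(1) S assms(5,6) by (cases i) auto
  moreover have "pCons c P \<circ>\<^sub>p [:q, s:] =
      [:poly (pCons c P) q, s * poly (pderiv (pCons c P)) q:] + smult (s ^ 2) (pCons 0 (pCons 0 ?R))"
    unfolding pcompose_pCons R(2)
    by (simp add: pderiv_pCons algebra_simps power2_eq_square smult_add_right)
  ultimately show ?case by blast
qed

locale hasse_schmidt_derivation = constant_embedding emb
  for emb :: "'k::alg_closed_field \<Rightarrow> 'f::field" +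
  fixes D :: "nat \<Rightarrow> 'f \<Rightarrow> 'f"
  assumes hasse_schmidt: "hasse_schmidt emb D"
begin

lemma D_0 [simp]: "D 0 f = f"
  and D_add: "D n (f + g) = D n f + D n g"
  and D_smult: "D n (emb c * f) = emb c * D n f"
  and D_mult: "D n (f * g) = (\<Sum>i\<le>n. D i f * D (n - i) g)"
  and D_emb: "1 \<le> n \<Longrightarrow> D n (emb c) = 0"
  using hasse_schmidt unfolding hasse_schmidt_def by blast+

lemma D_zero: "D n 0 = 0"
  using D_smult[of n 0 0] by (simp add: emb_simps)

text \<open>
The product rule for \<open>D\<close> is the multiplicativity of this map, so that polynomial equations between
functions carry over to their Taylor series.
\<close>

definition taylor :: "'f \<Rightarrow> 'f fps" where
  "taylor f = Abs_fps (\<lambda>n. D n f)"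

lemma taylor_nth [simp]: "fps_nth (taylor f) n = D n f"
  by (simp add: taylor_def)

sublocale taylor: idom_hom taylor
proof
  show "taylor 0 = 0" by (simp add: fps_eq_iff D_zero)
  show "taylor 1 = 1" using D_emb[of _ 1] by (auto simp: fps_eq_iff emb_simps)
  show "taylor (f + g) = taylor f + taylor g" for f g by (simp add: fps_eq_iff D_add)
  show "taylor (f * g) = taylor f * taylor g" for f g
    by (simp add: fps_eq_iff D_mult fps_mult_nth atLeast0AtMost)
qed

end

locale hasse_schmidt_valuation = hasse_schmidt_derivation emb D + valuation_subring emb A
  for emb :: "'k::alg_closed_field \<Rightarrow> 'f::field" and D and A
begin

text \<open>
The functions that stay regular under all \<open>D n\<close>.  The aim of this section is to show that at an
unramified point these are all regular functions.
\<close>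

definition stable :: "'f set" where
  "stable = {f. \<forall>n. D n f \<in> A}"

lemma stable_in:
  assumes "f \<in> stable"
  shows "f \<in> A"
proof -
  have "D 0 f \<in> A" using assms unfolding stable_def by blast
  then show ?thesis by simp
qed

lemma emb_stable: "emb c \<in> stable"
  unfolding stable_def
proof (intro CollectI allI)
  show "D n (emb c) \<in> A" for n
    using D_emb[of n c] emb_in zero_in by (cases "n = 0") auto
qed

lemma add_stable: "f \<in> stable \<Longrightarrow> g \<in> stable \<Longrightarrow> f + g \<in> stable"
  unfolding stable_def by (simp add: D_add add_in)

lemma mult_stable: "f \<in> stable \<Longrightarrow> g \<in> stable \<Longrightarrow> f * g \<in> stable"
  unfolding stable_def by (auto simp: D_mult intro!: sum_in mult_in)

lemma power_stable: "f \<in> stable \<Longrightarrow> f ^ n \<in> stable"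
  using emb_stable[of 1] by (induct n) (simp_all add: mult_stable emb_simps)

lemma ev_stable:
  assumes "f \<in> stable"
  shows "ev p f \<in> stable"
proof (induct p)
  case 0
  show ?case using emb_stable[of 0] by (simp add: emb_simps)
next
  case (pCons c p)
  then show ?case using assms by (simp add: add_stable mult_stable emb_stable)
qed

text \<open>
A form of Hensel's lemma.  The Taylor series of \<open>g\<close> is a root of the polynomial \<open>taylor(G)\<close>, and comparing
the coefficients of degree \<open>n\<close> expresses \<open>D n g\<close> times \<open>G'(g)\<close> by the \<open>D i g\<close> with \<open>i < n\<close>.  Since \<open>G'(g)\<close>
is a unit, regularity passes to \<open>D n g\<close>.
\<close>

lemma simple_root_stable:
  assumes G: "\<And>i. coeff G i \<in> stable" and g: "g \<in> A" "poly G g = 0"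
    and simple: "poly (pderiv G) g \<in> A - nonunits"
  shows "g \<in> stable"
proof -
  have "D n g \<in> A" for n
  proof (induct n rule: less_induct)
    case (less n)
    show ?case
    proof (cases "n = 0")
      case False
      let ?S = "{F. \<forall>i. fps_nth F i \<in> A}" and ?H = "map_poly taylor G"
      let ?a = "fps_cutoff n (taylor g)" and ?b = "fps_shift n (taylor g)"
      have split: "taylor g = ?a + fps_X ^ n * ?b"
        by (simp add: fps_eq_iff fps_X_power_mult_nth)
      obtain r where r: "poly ?H (taylor g) = poly ?H ?a + fps_X ^ n * ?b * poly (pderiv ?H) ?a + (fps_X ^ n * ?b) ^ 2 * r"
        using poly_taylor_two[of ?H ?a "fps_X ^ n * ?b"] split by metis
      have a: "?a \<in> ?S" using less zero_in by simp
      have in_S: "poly (map_poly taylor Q) ?a \<in> ?S" if "\<And>i. coeff Q i \<in> stable" for Q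
        using that
      proof (induct Q)
        case 0
        then show ?case using zero_in by simp
      next
        case (pCons c Q)
        have "c \<in> stable" "poly (map_poly taylor Q) ?a \<in> ?S"
          using pCons(2) pCons(3)[of 0] pCons(3)[of "Suc _"] by simp_all
        then show ?case
          using a unfolding stable_def
          by (auto simp: taylor.map_poly_pCons_hom fps_mult_nth simp del: fps_cutoff_nth intro!: add_in sum_in mult_in)
      qed
      have nth_0: "fps_nth (poly (map_poly taylor Q) ?a) 0 = poly Q g" for Q
        using False by (induct Q) (simp_all add: taylor.map_poly_pCons_hom)
      have "fps_nth (poly ?H (taylor g)) n = 0"
        using g(2) by (simp add: taylor.poly_map_poly)
      moreover have "fps_nth ((fps_X ^ n * ?b) ^ 2 * r) n = 0"
        using False by (simp add: power_mult_distrib mult.assoc fps_X_power_mult_nth flip: power_mult)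
      moreover have "fps_nth (fps_X ^ n * ?b * poly (pderiv ?H) ?a) n = D n g * poly (pderiv G) g"
        using nth_0[of "pderiv G"] by (simp add: mult.assoc fps_X_power_mult_nth taylor.map_poly_pderiv)
      ultimately have "D n g * poly (pderiv G) g = - fps_nth (poly ?H ?a) n"
        unfolding r by (simp add: eq_neg_iff_add_eq_0 add.commute)
      moreover have "fps_nth (poly ?H ?a) n \<in> A" using in_S[OF G] by blast
      ultimately have "D n g * poly (pderiv G) g \<in> A" using neg_in by simp
      then have "D n g * poly (pderiv G) g * inverse (poly (pderiv G) g) \<in> A"
        using inverse_unit[OF simple] by (intro mult_in[of "D n g * poly (pderiv G) g"]) blast+
      moreover have "poly (pderiv G) g \<noteq> 0" using simple zero_nonunit by auto
      ultimately show ?thesis by (simp add: mult.assoc)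
    qed (use g in simp)
  qed
  then show ?thesis unfolding stable_def by blast
qed

text \<open>
The inverse of \<open>h\<close> is the root of \<open>h Y - 1\<close>, whose derivative \<open>h\<close> is a unit.
\<close>

lemma inverse_stable:
  assumes "h \<in> stable" "h \<notin> nonunits"
  shows "inverse h \<in> stable"
proof (rule simple_root_stable[of "[:- 1, h:]"])
  have u: "h \<in> A - nonunits" using assms stable_in by blast
  show "inverse h \<in> A" using unit_inverse u by blast
  show "poly [:- 1, h:] (inverse h) = 0" using u zero_nonunit by (cases "h = 0") auto
  show "poly (pderiv [:- 1, h:]) (inverse h) \<in> A - nonunits" using u by (simp add: pderiv_pCons)
  show "coeff [:- 1, h:] i \<in> stable" for i
    using assms(1) emb_stable[of "- 1"] emb_stable[of 0]
    by (auto simp: coeff_pCons emb_simps split: nat.splits)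
qed

end

text \<open>
The situation at an unramified point, with \<open>t\<close> standing for \<open>x\<close> minus its value there: \<open>t\<close> is a local
parameter, and \<open>D\<close> is differentiation with respect to it.
\<close>

locale hasse_schmidt_uniformizer = hasse_schmidt_valuation emb D A
  for emb :: "'k::alg_closed_field \<Rightarrow> 'f::field" and D and A +
  fixes t :: 'f
  assumes t_nonunit: "t \<in> nonunits"
    and D_t: "D 1 t = 1" "\<And>n. 2 \<le> n \<Longrightarrow> D n t = 0"
    and unit_form: "f \<noteq> 0 \<Longrightarrow> \<exists>j. f / t powi j \<in> A - nonunits"
    and algebraic: "algebraic_over (ratfuns emb t)"
begin

lemma t_nonzero: "t \<noteq> 0"
  using D_t(1) D_zero by force

lemma proper: "A \<noteq> UNIV"
  using t_nonunit t_nonzero unfolding nonunits_def by blast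

lemma t_in: "t \<in> A" by (rule nonunits_in[OF t_nonunit])

lemma nat_exponent:
  assumes "f \<in> A" "f / t powi j \<in> A - nonunits"
  shows "0 \<le> j" "f \<in> nonunits \<Longrightarrow> 1 \<le> j"
proof -
  have *: "f / t powi j = f * t powi (- j)" by (simp add: power_int_minus divide_inverse)
  show "0 \<le> j"
  proof (rule ccontr)
    assume "\<not> 0 \<le> j"
    then show False using nonunits_mult[OF assms(1) powi_nonunit[OF t_nonunit, of "- j"]] assms(2) * by simp
  qed
  assume f: "f \<in> nonunits"
  show "1 \<le> j"
  proof (rule ccontr)
    assume "\<not> 1 \<le> j"
    then show False using nonunits_mult[OF powi_in[OF t_nonunit, of "- j"] f] assms(2) * by (simp add: mult.commute)
  qed
qed

lemma divide_t_in:
  assumes "a \<in> nonunits"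
  shows "a / t \<in> A"
proof (cases "a = 0")
  case False
  then obtain j where j: "a / t powi j \<in> A - nonunits" using unit_form by blast
  then have "1 \<le> j" using nat_exponent(2)[of a j] assms nonunits_in by blast
  moreover have "a / t = (a / t powi j) * t powi (j - 1)" using t_nonzero by (simp add: power_int_diff)
  ultimately show ?thesis using j mult_in[OF _ powi_in[OF t_nonunit, of "j - 1"], of "a / t powi j"] by simp
qed (simp add: zero_in)

lemma t_stable: "t \<in> stable"
  unfolding stable_def
proof (intro CollectI allI)
  fix n :: nat
  consider "n = 0" | "n = 1" | "2 \<le> n" by linarith
  then show "D n t \<in> A" using D_t t_in one_in zero_in by cases auto
qed

lemma ratfuns_stable:
  assumes "h \<in> ratfuns emb t" "h \<in> A"
  shows "h \<in> stable"
proof (cases "h = 0")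
  case True
  then show ?thesis using emb_stable[of 0] by (simp add: emb_simps)
next
  case False
  then obtain j p q where pq: "h = t powi j * (ev p t / ev q t)" "poly p 0 \<noteq> 0" "poly q 0 \<noteq> 0"
    using ratfuns_unit_form[OF t_nonunit t_nonzero assms(1)] by blast
  have "0 \<le> j"
    using nat_exponent(1)[OF assms(2), of j] ratio_unit[OF t_nonunit pq(2,3)] pq(1) t_nonzero by simp
  then obtain n where "j = int n" using zero_le_imp_eq_int by blast
  then have "h = t ^ n * (ev p t * inverse (ev q t))" using pq(1) by (simp add: divide_inverse)
  also have "\<dots> \<in> stable"
    using ev_unit[OF t_nonunit pq(3)]
    by (intro mult_stable power_stable ev_stable t_stable inverse_stable) auto
  finally show ?thesis .
qed

text \<open>
Regular functions have Taylor expansions in \<open>t\<close> with constant coefficients, because the residue field is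
that of the constants.
\<close>

lemma ex_approximation:
  assumes "f \<in> A"
  shows "\<exists>q g. q \<in> ratfuns emb t \<and> q \<in> A \<and> g \<in> A \<and> f = q + t ^ M * g"
proof (induct M)
  case 0
  show ?case using subfield_setD(1)[OF subfield_set_ratfuns[of t]] zero_in assms
    by (intro exI[of _ 0] exI[of _ f]) simp
next
  case (Suc M)
  then obtain q g where qg: "q \<in> ratfuns emb t" "q \<in> A" "g \<in> A" "f = q + t ^ M * g" by blast
  obtain c where c: "g - emb c \<in> nonunits" using ex_residue[OF proper algebraic qg(3)] by blast
  have tM: "t ^ M \<in> ratfuns emb t" using poly_in_ratfuns[of "[:0, 1:] ^ M" t] by simp
  have "q + emb c * t ^ M \<in> ratfuns emb t"
    by (rule subfield_setD(3)[OF subfield_set_ratfuns qg(1) subfield_setD(5)[OF subfield_set_ratfuns emb_in_ratfuns tM]])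
  moreover have "q + emb c * t ^ M \<in> A" using qg(2) t_in emb_in by (intro add_in mult_in power_in)
  moreover have "(g - emb c) / t \<in> A" using divide_t_in[OF c] .
  moreover have "f = (q + emb c * t ^ M) + t ^ Suc M * ((g - emb c) / t)"
    using qg(4) t_nonzero by (simp add: field_simps)
  ultimately show ?case by blast
qed

text \<open>
The separable equation of \<open>f\<close> over \<open>k(t)\<close> need not have a unit as derivative at \<open>f\<close>, so
\<open>simple_root_stable\<close> does not apply directly.  If that derivative has order \<open>e\<close>, write
\<open>f = q + t ^ (e + 1) g\<close> with \<open>q\<close> in \<open>k(t)\<close>.  The equation of \<open>g\<close> obtained by substitution is divisible by
\<open>t ^ (2 e + 1)\<close>, and after the division its derivative at \<open>g\<close> is a unit.
\<close>

lemma separable_stable: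
  assumes f: "f \<in> A" and P: "\<And>i. coeff P i \<in> ratfuns emb t" "poly P f = 0" "poly (pderiv P) f \<noteq> 0"
  shows "f \<in> stable"
proof -
  let ?F = "ratfuns emb t"
  have "P \<noteq> 0" using P(3) by auto
  then obtain k where k: "coeff P k \<noteq> 0" "\<And>i. coeff P i / coeff P k \<in> A"
    using ex_normalizing_coeff by blast
  define Q where "Q = smult (1 / coeff P k) P"
  define S where "S = ?F \<inter> A"
  have S: "0 \<in> S" "\<And>a b. a \<in> S \<Longrightarrow> b \<in> S \<Longrightarrow> a + b \<in> S" "\<And>a b. a \<in> S \<Longrightarrow> b \<in> S \<Longrightarrow> a * b \<in> S"
    unfolding S_def using subfield_setD[OF subfield_set_ratfuns[of t]] zero_in add_in mult_in by auto
  have Q: "\<And>i. coeff Q i \<in> S" "poly Q f = 0" "poly (pderiv Q) f \<noteq> 0"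
    using k P subfield_setD(6)[OF subfield_set_ratfuns[of t]]
    unfolding Q_def S_def by (auto simp: pderiv_smult)
  have of_nat: "of_nat n * b \<in> S" if "b \<in> S" for n b
    by (induct n) (auto simp: S that distrib_right)
  have Q': "coeff (pderiv Q) i \<in> S" for i
    unfolding coeff_pderiv by (rule of_nat[OF Q(1)])
  have Q'A: "poly (pderiv Q) f \<in> A" using Q' f unfolding S_def by (intro poly_in) auto
  obtain j where j: "poly (pderiv Q) f / t powi j \<in> A - nonunits" using unit_form[OF Q(3)] by blast
  then obtain e where e: "j = int e" using nat_exponent(1)[OF Q'A] zero_le_imp_eq_int by blast
  obtain q g where qg: "q \<in> S" "g \<in> A" "f = q + t ^ Suc e * g"
    using ex_approximation[OF f, of "Suc e"] unfolding S_def by blast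
  let ?s = "t ^ Suc e"
  have sF: "t ^ n \<in> ?F" for n using poly_in_ratfuns[of "[:0, 1:] ^ n" t] by simp
  have sS: "t ^ n \<in> S" for n unfolding S_def using sF power_in[OF t_in] by blast
  have f_eq: "poly [:q, ?s:] g = f" unfolding qg(3) by simp
  obtain R where R: "\<forall>i. coeff R i \<in> S"
    "Q \<circ>\<^sub>p [:q, ?s:] = [:poly Q q, ?s * poly (pderiv Q) q:] + smult (?s ^ 2) (pCons 0 (pCons 0 R))"
    using pcompose_taylor_two[OF S Q(1) qg(1) sS[of "Suc e"]] by blast
  obtain R' where R': "\<forall>i. coeff R' i \<in> S"
    "pderiv Q \<circ>\<^sub>p [:q, ?s:] = [:poly (pderiv Q) q, ?s * poly (pderiv (pderiv Q)) q:] + smult (?s ^ 2) (pCons 0 (pCons 0 R'))"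
    using pcompose_taylor_two[OF S Q' qg(1) sS[of "Suc e"]] by blast
  have RA: "poly R g \<in> A" "poly R' g \<in> A" using R(1) R'(1) qg(2) unfolding S_def by (auto intro!: poly_in)
  have tz: "t ^ n \<noteq> 0" for n using t_nonzero by simp
  have polyF: "poly T q \<in> ?F" if "\<And>i. coeff T i \<in> S" for T
    using that qg(1) unfolding S_def by (intro subfield_set_poly[OF subfield_set_ratfuns]) auto
  have polyA: "poly T q \<in> A" if "\<And>i. coeff T i \<in> S" for T
    using that qg(1) unfolding S_def by (intro poly_in) auto
  \<comment> \<open>The coefficients of degree \<open>0\<close> and \<open>1\<close> of the divided equation of \<open>g\<close>.\<close>
  define u where "u = poly (pderiv Q) q / t ^ e"
  define w where "w = poly Q q / (?s * t ^ e)"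
  have u: "u \<in> A - nonunits"
  proof -
    let ?v = "t * (poly (pderiv (pderiv Q)) q * g + ?s * (g * (g * poly R' g)))"
    have "poly (pderiv Q) f = poly (pderiv Q) q + ?s * (poly (pderiv (pderiv Q)) q * g + ?s * (g * (g * poly R' g)))"
      using arg_cong[OF R'(2), of "\<lambda>P. poly P g"] f_eq
      by (simp add: poly_pcompose power2_eq_square algebra_simps)
    then have "poly (pderiv Q) f / t ^ e = u + ?v"
      unfolding u_def using tz[of e] by (simp add: field_simps)
    then have uv: "u + ?v \<in> A - nonunits" using j e by simp
    have "coeff (pderiv (pderiv Q)) i \<in> S" for i
      unfolding coeff_pderiv[of "pderiv Q"] by (rule of_nat[OF Q'])
    then have "poly (pderiv (pderiv Q)) q \<in> A" by (rule polyA)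
    then have "poly (pderiv (pderiv Q)) q * g + ?s * (g * (g * poly R' g)) \<in> A"
      using RA(2) qg(2) t_in by (intro add_in mult_in power_in)
    then have v: "?v \<in> nonunits" using nonunits_mult t_nonunit by (metis mult.commute)
    have "u = (u + ?v) - ?v" by simp
    then have "u \<in> A" using diff_in uv nonunits_in[OF v] by (metis DiffD1)
    moreover have "u \<notin> nonunits" using nonunits_add[OF _ v] uv by blast
    ultimately show ?thesis by blast
  qed
  have w_eq: "w = - (u * g + t * (g * (g * poly R g)))"
  proof -
    have "0 = poly Q q + ?s * (poly (pderiv Q) q * g) + ?s * ?s * (g * (g * poly R g))"
      using arg_cong[OF R(2), of "\<lambda>P. poly P g"] f_eq Q(2)
      by (simp add: poly_pcompose power2_eq_square algebra_simps)
    also have "\<dots> = ?s * t ^ e * (w + u * g + t * (g * (g * poly R g)))"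
      unfolding w_def u_def using tz[of e] t_nonzero by (simp add: field_simps)
    finally have "w + u * g + t * (g * (g * poly R g)) = 0"
      using tz[of e] tz[of "Suc e"] by (metis mult_eq_0_iff)
    then show ?thesis by (simp only: eq_neg_iff_add_eq_0 add.assoc)
  qed
  have "w \<in> A"
    unfolding w_eq using u RA(1) qg(2) t_in by (intro neg_in add_in mult_in) auto
  moreover have "w \<in> ?F" "u \<in> ?F"
    unfolding w_def u_def
    by (rule subfield_setD(6)[OF subfield_set_ratfuns polyF subfield_setD(5)[OF subfield_set_ratfuns sF sF]], rule Q(1))
      (rule subfield_setD(6)[OF subfield_set_ratfuns polyF sF], rule Q')
  ultimately have wu: "w \<in> stable" "u \<in> stable" using ratfuns_stable u by blast+
  define G where "G = [:w, u:] + smult t (pCons 0 (pCons 0 R))"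
  have "g \<in> stable"
  proof (rule simple_root_stable[of G])
    have "coeff R i \<in> stable" for i using R(1) ratfuns_stable unfolding S_def by blast
    then show "coeff G i \<in> stable" for i
      using wu t_stable emb_stable[of 0] unfolding G_def
      by (auto simp: coeff_pCons emb_simps intro!: add_stable mult_stable split: nat.splits)
    show "g \<in> A" by (fact qg(2))
    have "poly G g = w + (u * g + t * (g * (g * poly R g)))" unfolding G_def by (simp add: algebra_simps)
    then show "poly G g = 0" unfolding w_eq by simp
    have "coeff (pderiv R) i \<in> A" for i
      unfolding coeff_pderiv using R(1) of_nat unfolding S_def by blast
    then have "poly (pderiv R) g \<in> A" using qg(2) by (rule poly_in)
    moreover have "2 * poly R g \<in> A" using add_in[OF RA(1) RA(1)] by simp
    ultimately have "g * (2 * poly R g + g * poly (pderiv R) g) \<in> A"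
      using qg(2) mult_in add_in by blast
    then have "(g * (2 * poly R g + g * poly (pderiv R) g)) * t \<in> nonunits"
      by (rule nonunits_mult[OF _ t_nonunit])
    moreover have "poly (pderiv G) g = u + (g * (2 * poly R g + g * poly (pderiv R) g)) * t"
      unfolding G_def by (simp add: pderiv_add pderiv_smult pderiv_pCons algebra_simps)
    ultimately show "poly (pderiv G) g \<in> A - nonunits"
      using u add_in nonunits_in nonunits_diff[of "u + _" ] by (metis DiffD1 DiffD2 DiffI add_diff_cancel_right')
  qed
  then show ?thesis
    unfolding qg(3) using qg(1) t_stable ratfuns_stable unfolding S_def
    by (intro add_stable mult_stable power_stable) auto
qed

text \<open>
Each application of the product rule to a factor \<open>t\<close> either keeps that factor or replaces it by \<open>1\<close> at
the cost of one order of differentiation.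
\<close>

lemma D_order:
  assumes "\<And>f. f \<in> A \<Longrightarrow> f \<in> stable" and "f / t ^ m \<in> A" "n \<le> m"
  shows "D n f / t ^ (m - n) \<in> A"
  using assms(2,3)
proof (induct m arbitrary: n f)
  case 0
  then show ?case by simp
next
  case (Suc m)
  define h where "h = f / t"
  have h: "f = t * h" "h / t ^ m \<in> A" unfolding h_def using Suc(2) t_nonzero by simp_all
  have "D i f = t * D i h + (if i = 0 then 0 else D (i - 1) h)" for i
  proof (cases i)
    case (Suc k)
    have "D i f = (\<Sum>j\<le>Suc k. D j t * D (Suc k - j) h)" unfolding h(1) D_mult Suc ..
    also have "\<dots> = (\<Sum>j\<in>{0, 1}. D j t * D (Suc k - j) h)"
      by (rule sum.mono_neutral_right) (auto simp: D_t(2))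
    finally show ?thesis using D_t(1) Suc by simp
  qed (simp add: h)
  note Df = this
  have hA: "h \<in> A"
    using mult_in[OF h(2) power_in[OF t_in, of m]] t_nonzero by simp
  show ?case
  proof (cases "n = Suc m")
    case True
    have "f \<in> stable" using assms(1) h(1) mult_in[OF t_in hA] by simp
    then show ?thesis using True unfolding stable_def by simp
  next
    case False
    then have n: "n \<le> m" using Suc(3) by simp
    then have "t * D n h / t ^ (Suc m - n) = D n h / t ^ (m - n)"
      using t_nonzero by (simp add: Suc_diff_le)
    then have 1: "t * D n h / t ^ (Suc m - n) \<in> A" using Suc(1)[OF h(2) n] by simp
    show ?thesis
    proof (cases "n = 0")
      case True
      then show ?thesis using Suc(2) by simp
    next
      case False
      then have "D (n - 1) h / t ^ (Suc m - n) \<in> A" using Suc(1)[OF h(2), of "n - 1"] n by (simp add: Suc_diff_le)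
      then show ?thesis using add_in[OF 1] False unfolding Df by (simp add: add_divide_distrib)
    qed
  qed
qed

end

lemma algebraic_over_if_separable_ext: "separable_ext_of F \<Longrightarrow> algebraic_over F"
  unfolding separable_ext_of_def algebraic_over_def is_min_poly_over_def
  by (metis leading_coeff_0_iff zero_neq_one)

lemma coprime_pderiv_root:
  fixes P :: "'a::field poly"
  assumes "coprime P (pderiv P)" "poly P f = 0"
  shows "poly (pderiv P) f \<noteq> 0"
proof
  assume "poly (pderiv P) f = 0"
  then have "[:- f, 1:] dvd 1"
    using assms by (meson coprime_common_divisor poly_eq_0_iff_dvd)
  then show False using poly_eq_0_iff_dvd[of 1 f] by simp
qed

section \<open>The function attached to a torsion point\<close>

text \<open>
The \<open>N\<close>-th power of the coset of \<open>[\<xi>] - [\<infinity>]\<close> contains \<open>N[\<xi>] - N[\<infinity>]\<close>, and by assumption that power is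
the set of principal divisors.
\<close>

lemma torsion_function:
  assumes "\<xi> \<in> torsion_points emb infty N" and infty: "infty \<in> points emb" and "constant_embedding emb"
  shows "\<exists>f. f \<noteq> 0 \<and> (\<forall>\<zeta>\<in>points emb. \<zeta> f = (if \<zeta> = \<xi> then int N else 0) - (if \<zeta> = infty then int N else 0))"
proof -
  interpret constant_embedding emb by (fact assms(3))
  let ?H = "principal_divisors emb" and ?a = "frag_of \<xi> - frag_of infty" and ?G = "divisors0 emb"
  have xi: "\<xi> \<in> points emb" and tors: "(?H #>\<^bsub>?G\<^esub> ?a) [^]\<^bsub>jacobian emb\<^esub> N = ?H"
    using assms(1) unfolding torsion_points_def jacobian_torsion_def jacobian_embedding_def
    by (auto simp: jacobian_def FactGroup_def)
  have mult: "x \<otimes>\<^bsub>?G\<^esub> y = x + y" for x y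
    by (simp add: divisors0_def free_Abelian_group_def)
  have "\<zeta> 1 = 0" if "\<zeta> \<in> points emb" for \<zeta>
    using that emb.hom_one unfolding points_def by (metis (mono_tags, lifting) mem_Collect_eq one_neq_zero)
  then have 0: "0 \<in> ?H"
    unfolding principal_divisors_def by (auto simp: free_Abelian_group_def intro!: exI[of _ 1])
  have a: "?a \<in> ?H #>\<^bsub>?G\<^esub> ?a"
    unfolding r_coset_def using 0 mult by force
  have "frag_cmul (int n) ?a \<in> (?H #>\<^bsub>?G\<^esub> ?a) [^]\<^bsub>jacobian emb\<^esub> n" for n
  proof (induct n)
    case 0
    show ?case using \<open>0 \<in> ?H\<close> by (simp add: nat_pow_def jacobian_def FactGroup_def)
  next
    case (Suc n)
    have "frag_cmul (int (Suc n)) ?a = frag_cmul (int n) ?a \<otimes>\<^bsub>?G\<^esub> ?a"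
      unfolding mult by (simp add: frag_cmul_distrib)
    also have "\<dots> \<in> ((?H #>\<^bsub>?G\<^esub> ?a) [^]\<^bsub>jacobian emb\<^esub> n) <#>\<^bsub>?G\<^esub> (?H #>\<^bsub>?G\<^esub> ?a)"
      using Suc a unfolding set_mult_def by blast
    also have "\<dots> = (?H #>\<^bsub>?G\<^esub> ?a) [^]\<^bsub>jacobian emb\<^esub> Suc n"
      by (simp add: nat_pow_def jacobian_def FactGroup_def)
    finally show ?case .
  qed
  then have "frag_cmul (int N) ?a \<in> ?H" using tors by metis
  then obtain f where f: "f \<noteq> 0" "\<And>\<zeta>. \<zeta> \<in> points emb \<Longrightarrow> Poly_Mapping.lookup (frag_cmul (int N) ?a) \<zeta> = \<zeta> f"
    unfolding principal_divisors_def by blast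
  have "\<zeta> f = (if \<zeta> = \<xi> then int N else 0) - (if \<zeta> = infty then int N else 0)" if "\<zeta> \<in> points emb" for \<zeta>
    unfolding f(2)[OF that, symmetric]
    by (auto simp: lookup_frag_cmul lookup_minus lookup_single when_def)
  then show ?thesis using f(1) by blast
qed

section \<open>Functions with poles only at infinity\<close>

lemma delta_range:
  assumes "infinite (pole_orders emb infty)"
  shows "{n. 1 \<le> n \<and> delta emb infty n \<le> M} = {1..num_pole_orders emb infty M}"
proof -
  let ?e = "enumerate (pole_orders emb infty)"
  define k where "k = (LEAST m. M < ?e m)"
  have ex: "M < ?e (Suc M)" using le_enumerate[OF assms, of "Suc M"] by simp
  have iff: "?e m \<le> M \<longleftrightarrow> m < k" for m
  proof
    assume "?e m \<le> M"
    moreover have "M < ?e k" unfolding k_def by (rule LeastI[of "\<lambda>m. M < ?e m", OF ex])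
    ultimately show "m < k"
      using strict_mono_less[OF strict_mono_enumerate[OF assms], of m k] by linarith
  next
    assume "m < k"
    then have "\<not> M < ?e m" unfolding k_def by (rule not_less_Least)
    then show "?e m \<le> M" by simp
  qed
  have "{n. 1 \<le> n \<and> delta emb infty n \<le> M} = {1..k}"
    unfolding delta_def iff by auto
  then show ?thesis unfolding num_pole_orders_def by simp
qed

lemma delta_surj:
  assumes "infinite (pole_orders emb infty)" "p \<in> pole_orders emb infty" "p \<le> M"
  shows "\<exists>n\<in>{1..num_pole_orders emb infty M}. delta emb infty n = p"
proof -
  obtain m where "enumerate (pole_orders emb infty) m = p"
    using enumerate_Ex[OF _ assms(2)] assms(1) by blast
  then have "delta emb infty (Suc m) = p" by (simp add: delta_def)
  then show ?thesis using delta_range[OF assms(1), of M] assms(3) by (intro bexI[of _ "Suc m"]) auto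
qed

locale curve = function_field_point emb infty
  for emb :: "'k::alg_closed_field \<Rightarrow> 'f::field" and infty +
  fixes x :: 'f and d :: nat
  assumes function_field: "function_field emb"
    and d: "1 \<le> d"
    and x_regular: "regular_away_from emb infty x"
    and x_pole: "pole_of_order infty x d"
    and separable: "separable_ext_of (ratfuns emb x)"
begin

lemma regular_away_const: "regular_away_from emb infty (emb c)"
    and regular_away_add: "regular_away_from emb infty f \<Longrightarrow> regular_away_from emb infty g \<Longrightarrow> regular_away_from emb infty (f + g)"
    and regular_away_mult: "regular_away_from emb infty f \<Longrightarrow> regular_away_from emb infty g \<Longrightarrow> regular_away_from emb infty (f * g)"
proof -
  have point: "function_field_point emb \<eta>" if "\<eta> \<in> points emb" for \<eta>
    using that by unfold_locales
  have eq: "regular_at \<eta> f \<longleftrightarrow> zero_of_order_ge \<eta> f 0" for \<eta> :: "'f point" and f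
    by (simp add: regular_at_def zero_of_order_ge_def)
  show "regular_away_from emb infty (emb c)"
    unfolding regular_away_from_def eq using function_field_point.order_ge_const[OF point] by blast
  show "regular_away_from emb infty f \<Longrightarrow> regular_away_from emb infty g \<Longrightarrow> regular_away_from emb infty (f + g)"
    unfolding regular_away_from_def eq using function_field_point.order_ge_add[OF point] by blast
  show "regular_away_from emb infty f \<Longrightarrow> regular_away_from emb infty g \<Longrightarrow> regular_away_from emb infty (f * g)"
    unfolding regular_away_from_def eq using function_field_point.order_ge_mult[OF point, of _ _ 0 _ 0] by auto
qed

lemma regular_away_power: "regular_away_from emb infty f \<Longrightarrow> regular_away_from emb infty (f ^ n)"
  using regular_away_const[of 1] by (induct n) (auto simp: regular_away_mult emb_simps)

text \<open>
If \<open>f\<close> were nonzero, its zero at infinity would make it nonconstant, and it would have a pole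
somewhere.
\<close>

lemma regular_everywhere_zero:
  assumes "regular_away_from emb infty f" "order_ge f 1"
  shows "f = 0"
proof (rule ccontr)
  assume "f \<noteq> 0"
  then have "inverse f \<notin> {f. order_ge f 0}" using assms(2) order_inverse[of f] by (simp add: zero_of_order_ge_def)
  then obtain \<eta> where eta: "\<eta> \<in> points emb" "\<eta> f < 0"
    using ex_pole[OF function_field] transcendental_if_notin by blast
  moreover have "\<eta> \<noteq> infty" using assms(2) \<open>f \<noteq> 0\<close> eta(2) by (auto simp: zero_of_order_ge_def)
  ultimately show False
    using assms(1) \<open>f \<noteq> 0\<close> unfolding regular_away_from_def regular_at_def by force
qed

lemma x_nonzero: "x \<noteq> 0" and order_x: "infty x = - int d"
  using x_pole unfolding pole_of_order_def by auto

lemma infinite_pole_orders: "infinite (pole_orders emb infty)"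
proof -
  have "n * d \<in> pole_orders emb infty" for n
    unfolding pole_orders_def pole_of_order_def
    using regular_away_power[OF x_regular, of n] order_power[OF x_nonzero, of n] x_nonzero order_x
    by (intro CollectI exI[of _ "x ^ n"]) simp
  then have "range (\<lambda>n. n * d) \<subseteq> pole_orders emb infty" by blast
  moreover have "inj (\<lambda>n. n * d)" using d by (intro injI) simp
  ultimately show ?thesis using infinite_super range_inj_infinite by blast
qed

definition pole_basis :: "(nat \<Rightarrow> 'f) \<Rightarrow> bool" where
  "pole_basis y \<longleftrightarrow> (\<forall>n\<ge>1. regular_away_from emb infty (y n) \<and> pole_of_order infty (y n) (delta emb infty n))"

text \<open>
The functions \<open>y n\<close> span the space \<open>L(M\<infinity>)\<close>: subtracting a multiple of the \<open>y n\<close> with the same pole order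
lowers the pole order, and the process ends with a function that has no pole and a zero at infinity.
\<close>

lemma pole_basis_span:
  assumes y: "pole_basis y" and f: "regular_away_from emb infty f" "order_ge f (- int M)"
  shows "\<exists>c. f = (\<Sum>n = 1..num_pole_orders emb infty M. emb (c n) * y n)"
proof -
  let ?I = "{1..num_pole_orders emb infty M}"
  have "\<exists>c. f = (\<Sum>n\<in>?I. emb (c n) * y n)" if "order_ge f (1 - int m)" "regular_away_from emb infty f" "m \<le> Suc M" for f m
    using that
  proof (induct m arbitrary: f)
    case 0
    then have "f = 0" using regular_everywhere_zero by simp
    then show ?case by (intro exI[of _ "\<lambda>_. 0"]) simp
  next
    case (Suc m)
    show ?case
    proof (cases "order_ge f (1 - int m)")
      case True
      then show ?thesis using Suc by simp
    next
      case False
      then have f: "f \<noteq> 0" "infty f = - int m" using Suc(2) by (auto simp: zero_of_order_ge_def)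
      then have "m \<in> pole_orders emb infty"
        using Suc(3) unfolding pole_orders_def pole_of_order_def by blast
      then obtain n where n: "n \<in> ?I" "delta emb infty n = m"
        using delta_surj[OF infinite_pole_orders, of m M] Suc(4) by auto
      have yn: "regular_away_from emb infty (y n)" "y n \<noteq> 0" "infty (y n) = - int m"
        using y n unfolding pole_basis_def pole_of_order_def by auto
      have "f / y n \<in> {f. order_ge f 0}" using f yn by (simp add: zero_of_order_ge_def order_divide)
      then obtain c where c: "f / y n - emb c \<in> nonunits"
        using ex_residue[OF proper_subring algebraic_over_if_separable_ext[OF separable]] by blast
      let ?g = "f + emb (- c) * y n"
      have "?g = (f / y n - emb c) * y n" using yn(2) by (simp add: field_simps emb_simps)
      moreover have "order_ge (y n) (- int m)" using yn by (simp add: zero_of_order_ge_def)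
      ultimately have "order_ge ?g (1 - int m)"
        using c order_ge_mult[of "f / y n - emb c" 1 "y n" "- int m"] unfolding nonunits_eq by simp
      moreover have "regular_away_from emb infty ?g"
        using Suc(3) yn(1) regular_away_add regular_away_mult regular_away_const by blast
      ultimately obtain b where b: "?g = (\<Sum>n\<in>?I. emb (b n) * y n)" using Suc(1)[of ?g] Suc(4) by auto
      have "f = ?g + emb c * y n" by (simp add: emb_simps)
      also have "\<dots> = (\<Sum>k\<in>?I. emb (b k) * y k + (if k = n then emb c * y k else 0))"
        using n(1) by (simp add: b sum.distrib)
      also have "\<dots> = (\<Sum>k\<in>?I. emb (b k + (if k = n then c else 0)) * y k)"
        by (intro sum.cong) (auto simp: emb_simps distrib_right)
      finally show ?thesis by (rule exI[of _ "\<lambda>k. b k + (if k = n then c else 0)"])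
    qed
  qed
  from this[of f "Suc M"] f show ?thesis by simp
qed

end

section \<open>Minors\<close>

lemma Pi_minor_eq_det:
  fixes emb infty M s
  defines "n \<equiv> num_pole_orders emb infty M"
  defines "J \<equiv> (\<lambda>i. s i - 1) ` {1..n}"
  assumes "J \<subseteq> {..<M}" "card J = n"
  shows "Pi_minor emb infty D y M s = det (mat n n (\<lambda>(i, j). D (pick J j) (y (i + 1))))"
proof -
  have J: "{j. j < M \<and> j \<in> J} = J" using assms(3) by auto
  have "submatrix (hs_matrix emb infty D y M) UNIV J = mat n n (\<lambda>(i, j). D (pick J j) (y (i + 1)))"
  proof (rule eq_matI)
    fix i j assume "i < dim_row (mat n n (\<lambda>(i, j). D (pick J j) (y (i + 1))))"
      "j < dim_col (mat n n (\<lambda>(i, j). D (pick J j) (y (i + 1))))"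
    then have ij: "i < n" "j < n" by auto
    then have "pick J j \<in> J" using pick_in_set_le[of j J] assms(4) by simp
    then have "pick J j < M" using assms(3) by blast
    then show "submatrix (hs_matrix emb infty D y M) UNIV J $$ (i, j) = mat n n (\<lambda>(i, j). D (pick J j) (y (i + 1))) $$ (i, j)"
      using ij assms(4) by (subst submatrix_index) (simp_all add: hs_matrix_def J pick_UNIV flip: n_def)
  qed (simp_all add: dim_submatrix hs_matrix_def J assms(4) flip: n_def)
  then show ?thesis unfolding Pi_minor_def J_def n_def by simp
qed

text \<open>
With more rows than columns the matrix is not square, and its determinant is \<open>0\<close> by convention.
\<close>

lemma Delta_minor_eq_0:
  assumes "M < num_pole_orders emb infty M"
  shows "Delta_minor emb infty D y M = 0"
proof -
  let ?n = "num_pole_orders emb infty M"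
  have "(\<lambda>i. i - 1) ` {1..?n} = {..<?n}"
    by (auto simp: image_iff intro!: bexI[of _ "Suc _"])
  moreover have "{j. j < M \<and> j < ?n} = {..<M}" using assms by auto
  ultimately have "dim_col (submatrix (hs_matrix emb infty D y M) UNIV ((\<lambda>i. i - 1) ` {1..?n})) = M"
    "dim_row (submatrix (hs_matrix emb infty D y M) UNIV ((\<lambda>i. i - 1) ` {1..?n})) = ?n"
    by (simp_all add: dim_submatrix hs_matrix_def)
  then show ?thesis using assms unfolding Delta_minor_def Pi_minor_def det_def by simp
qed

lemma sum_le_sum_largest:
  assumes "S \<subseteq> {..<n::nat}"
  shows "(\<Sum>i\<in>S. int i) \<le> (\<Sum>i<card S. int n - 1 - int i)"
  using assms
proof (induct n arbitrary: S)
  case (Suc n)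
  have fin: "finite S" using Suc(2) finite_subset by blast
  show ?case
  proof (cases "n \<in> S")
    case True
    define T where "T = S - {n}"
    have T: "T \<subseteq> {..<n}" "card S = Suc (card T)" "(\<Sum>i\<in>S. int i) = int n + (\<Sum>i\<in>T. int i)"
      using Suc(2) True fin card.remove[OF fin True] sum.remove[OF fin True, of int] unfolding T_def by auto
    show ?thesis
      using Suc(1)[OF T(1)] unfolding T(2,3) by (simp add: sum.lessThan_Suc_shift diff_diff_eq del: sum.lessThan_Suc)
  next
    case False
    then have "S \<subseteq> {..<n}" using Suc(2) by (force simp: less_Suc_eq)
    moreover have "(\<Sum>i<card S. int n - 1 - int i) \<le> (\<Sum>i<card S. int (Suc n) - 1 - int i)"
      by (intro sum_mono) simp
    ultimately show ?thesis using order_trans[OF Suc(1)] by blast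
  qed
qed simp

lemma (in hasse_schmidt_derivation) D_linear:
  "D n (\<Sum>i\<in>I. emb (c i) * f i) = (\<Sum>i\<in>I. emb (c i) * D n (f i))"
  by (induct I rule: infinite_finite_induct) (simp_all add: D_zero D_add D_smult)

context curve
begin

text \<open>
Two families with the prescribed pole orders span the same spaces over the constants, and the
constants can be pulled out of the derivatives, so the minors differ by the determinant of a constant
matrix.  The map \<open>\<kappa>\<close> selects the columns of the minor.
\<close>

lemma det_change_basis:
  assumes "hasse_schmidt_derivation emb D" and y: "pole_basis y" and y': "pole_basis y'"
    and n_def: "n = num_pole_orders emb infty M"
  shows "\<exists>c. det (mat n n (\<lambda>(i, j). D (\<kappa> j) (y (i + 1)))) = emb c * det (mat n n (\<lambda>(i, j). D (\<kappa> j) (y' (i + 1))))"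
proof -
  interpret hasse_schmidt_derivation emb D by (fact assms(1))
  have "\<exists>c. y i = (\<Sum>k = 1..n. emb (c k) * y' k)" if "i \<in> {1..n}" for i
    unfolding n_def
  proof (rule pole_basis_span[OF y'])
    have "i \<in> {n. 1 \<le> n \<and> delta emb infty n \<le> M}"
      unfolding delta_range[OF infinite_pole_orders] using that n_def by simp
    then have "1 \<le> i" "delta emb infty i \<le> M" by simp_all
    then show "regular_away_from emb infty (y i)" "order_ge (y i) (- int M)"
      using y unfolding pole_basis_def pole_of_order_def zero_of_order_ge_def by auto
  qed
  then obtain c where c: "\<And>i. i \<in> {1..n} \<Longrightarrow> y i = (\<Sum>k = 1..n. emb (c i k) * y' k)" by metis
  let ?C = "mat n n (\<lambda>(i, k). c (i + 1) (k + 1))"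
  let ?B = "\<lambda>y. mat n n (\<lambda>(i, j). D (\<kappa> j) (y (i + 1)))"
  have "?B y = map_mat emb ?C * ?B y'"
  proof (rule eq_matI)
    fix i j assume "i < dim_row (map_mat emb ?C * ?B y')" "j < dim_col (map_mat emb ?C * ?B y')"
    then have ij: "i < n" "j < n" by auto
    have "D (\<kappa> j) (y (i + 1)) = (\<Sum>k = 1..n. emb (c (i + 1) k) * D (\<kappa> j) (y' k))"
      using c[of "i + 1"] ij by (simp add: D_linear)
    also have "\<dots> = (\<Sum>k = 0..<n. emb (c (i + 1) (k + 1)) * D (\<kappa> j) (y' (k + 1)))"
      by (rule sum.reindex_bij_witness[of _ "\<lambda>k. k + 1" "\<lambda>k. k - 1"]) auto
    finally show "?B y $$ (i, j) = (map_mat emb ?C * ?B y') $$ (i, j)"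
      using ij by (simp add: scalar_prod_def)
  qed auto
  then have "det (?B y) = emb (det ?C) * det (?B y')"
    by (simp add: det_mult[of _ n] emb.hom_det)
  then show ?thesis by blast
qed

section \<open>Orders of derivatives at an unramified point\<close>

text \<open>
Unramified means that \<open>x\<close> minus its value at \<open>\<xi>\<close> vanishes to order exactly \<open>1\<close>.
\<close>

lemma unramified_uniformizer:
  assumes xi: "\<xi> \<in> points emb" "\<xi> \<noteq> infty" "\<xi> \<notin> ramification_points emb x" and D: "hasse_schmidt_wrt emb x D"
  shows "\<exists>c. \<xi> (x - emb c) = 1 \<and> hasse_schmidt_uniformizer emb D {f. zero_of_order_ge \<xi> f 0} (x - emb c)"
proof -
  interpret Z: function_field_point emb \<xi> by unfold_locales (fact xi(1))
  have hs: "hasse_schmidt emb D" using D unfolding hasse_schmidt_wrt_def by blast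
  interpret hasse_schmidt_derivation emb D by unfold_locales (fact hs)
  have "x \<in> {f. zero_of_order_ge \<xi> f 0}"
    using x_regular xi unfolding regular_away_from_def regular_at_def zero_of_order_ge_def by blast
  then obtain c where "x - emb c \<in> Z.nonunits"
    using Z.ex_center[OF Z.proper_subring algebraic_over_if_separable_ext[OF separable]] by blast
  define t where "t = x - emb c"
  have t_non: "t \<in> Z.nonunits" unfolding t_def by fact
  have "t \<noteq> 0" using order_x d order_const[of c] unfolding t_def by auto
  then have "1 \<le> \<xi> t" using t_non unfolding Z.nonunits_eq by (simp add: zero_of_order_ge_def)
  moreover have "\<not> 2 \<le> \<xi> t" using xi unfolding ramification_points_def t_def by blast
  ultimately have order_t: "\<xi> t = 1" by simp
  have D_pow: "D n (x powi m) = of_int (int_binomial m n) * x powi (m - int n)" for m n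
    using D unfolding hasse_schmidt_wrt_def by blast
  have D1: "D 1 x = 1" using D_pow[of 1 1] by (simp add: int_binomial_def)
  have D2: "D n x = 0" if "2 \<le> n" for n
  proof -
    have "(\<Prod>i<n. 1 - int i) = 0" using that by (intro prod_zero bexI[of _ 1]) auto
    then have "int_binomial 1 n = 0" unfolding int_binomial_def by (simp only: div_0)
    then show ?thesis using D_pow[of n 1] by simp
  qed
  have Dt: "D n t = D n x" if "1 \<le> n" for n
    using D_add[of n x "emb (- c)"] D_emb[OF that, of "- c"] unfolding t_def by (simp add: emb_simps)
  have sub: "ratfuns emb x \<subseteq> ratfuns emb t" unfolding t_def by (rule ratfuns_translate)
  have "hasse_schmidt_uniformizer emb D {f. zero_of_order_ge \<xi> f 0} t"
  proof unfold_locales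
    show "t \<in> Z.nonunits" by fact
    show "D 1 t = 1" using Dt[of 1] D1 by simp
    show "D n t = 0" if "2 \<le> n" for n using Dt[of n] D2 that by simp
    show "\<exists>j. f / t powi j \<in> {f. zero_of_order_ge \<xi> f 0} - Z.nonunits" if "f \<noteq> 0" for f
      unfolding Z.unit_iff using that \<open>t \<noteq> 0\<close> order_t
      by (intro exI[of _ "\<xi> f"]) (simp add: Z.order_divide Z.order_power_int)
    show "algebraic_over (ratfuns emb t)"
      by (rule algebraic_over_mono[OF algebraic_over_if_separable_ext[OF separable] sub])
  qed
  then show ?thesis using order_t unfolding t_def by blast
qed

text \<open>
The minimal polynomial of a function regular at \<open>\<xi>\<close> is separable, so all derivatives of the function are
regular by \<open>separable_stable\<close>, and \<open>D_order\<close> applies.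
\<close>

lemma order_D:
  assumes xi: "\<xi> \<in> points emb" "\<xi> \<noteq> infty" "\<xi> \<notin> ramification_points emb x" and D: "hasse_schmidt_wrt emb x D"
    and f: "zero_of_order_ge \<xi> f (int m)"
  shows "zero_of_order_ge \<xi> (D n f) (max 0 (int m - int n))"
proof -
  obtain c where order_t: "\<xi> (x - emb c) = 1"
    and hs: "hasse_schmidt_uniformizer emb D {f. zero_of_order_ge \<xi> f 0} (x - emb c)"
    using unramified_uniformizer[OF xi D] by blast
  define t where "t = x - emb c"
  interpret Z: function_field_point emb \<xi> by unfold_locales (fact xi(1))
  interpret hasse_schmidt_uniformizer emb D "{f. zero_of_order_ge \<xi> f 0}" t unfolding t_def by (fact hs)
  have sub: "ratfuns emb x \<subseteq> ratfuns emb t" unfolding t_def by (rule ratfuns_translate)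
  have stable: "g \<in> stable" if g: "g \<in> {f. zero_of_order_ge \<xi> f 0}" for g
  proof -
    obtain P where P: "is_min_poly_over (ratfuns emb x) g P" "coprime P (pderiv P)"
      using separable unfolding separable_ext_of_def by blast
    then have "poly P g = 0" "\<And>i. coeff P i \<in> ratfuns emb t"
      using sub unfolding is_min_poly_over_def by auto
    then show ?thesis using separable_stable[OF g] coprime_pderiv_root[OF P(2)] by blast
  qed
  have t: "zero_of_order_ge \<xi> (t ^ k) (int k)" "\<xi> (t ^ k) = int k" for k
    using order_t t_nonzero unfolding zero_of_order_ge_def t_def by (simp_all add: Z.order_power)
  have "zero_of_order_ge \<xi> (f / t ^ m) 0"
    using f t t_nonzero unfolding zero_of_order_ge_def by (cases "f = 0") (auto simp: Z.order_divide)
  have "zero_of_order_ge \<xi> f 0" using f by (rule Z.order_ge_mono) simp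
  then have "D n f \<in> {f. zero_of_order_ge \<xi> f 0}" using stable unfolding stable_def by blast
  show ?thesis
  proof (cases "n \<le> m")
    case True
    have "D n f / t ^ (m - n) \<in> {f. zero_of_order_ge \<xi> f 0}"
      using \<open>zero_of_order_ge \<xi> (f / t ^ m) 0\<close> by (intro D_order[OF stable _ True]) auto
    then have "zero_of_order_ge \<xi> (D n f / t ^ (m - n) * t ^ (m - n)) (0 + int (m - n))"
      using t by (intro Z.order_ge_mult) auto
    then show ?thesis using t_nonzero True by (simp add: of_nat_diff)
  next
    case False
    then show ?thesis using \<open>D n f \<in> _\<close> by simp
  qed
qed

end

section \<open>Unramified torsion points\<close>

text \<open>
Here \<open>f\<close> is the function with divisor \<open>N[\<xi>] - N[\<infinity>]\<close> and \<open>t\<close> the local parameter at \<open>\<xi>\<close> obtained from \<open>x\<close>.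
\<close>

locale unramified_torsion_point = curve emb infty x d + xi: function_field_point emb \<xi>
  for emb :: "'k::alg_closed_field \<Rightarrow> 'f::field" and infty x d and \<xi> :: "'f point" +
  fixes D :: "nat \<Rightarrow> 'f \<Rightarrow> 'f" and y :: "nat \<Rightarrow> 'f" and N :: nat and f t :: 'f
  assumes ne: "\<xi> \<noteq> infty"
    and unramified: "\<xi> \<notin> ramification_points emb x"
    and D: "hasse_schmidt_wrt emb x D"
    and y: "pole_basis y"
    and f: "f \<noteq> 0" "\<And>\<zeta>. \<zeta> \<in> points emb \<Longrightarrow>
      \<zeta> f = (if \<zeta> = \<xi> then int N else 0) - (if \<zeta> = infty then int N else 0)"
    and t: "\<exists>c. t = x - emb c" "\<xi> t = 1"
begin

lemma f_orders: "\<xi> f = int N" "infty f = - int N"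
  using f(2)[OF xi.point] f(2)[OF point] ne by auto

lemma f_regular: "regular_away_from emb infty f"
  unfolding regular_away_from_def regular_at_def
proof
  fix \<zeta> assume "\<zeta> \<in> points emb - {infty}"
  then show "f = 0 \<or> 0 \<le> \<zeta> f" using f(2)[of \<zeta>] by simp
qed

lemma t_nonzero: "t \<noteq> 0"
  using t(2) xi.order_zero by auto

lemma t_regular: "regular_away_from emb infty t"
  using t(1) regular_away_add[OF x_regular regular_away_const[of "- _"]] by (auto simp: emb_simps)

lemma t_pole: "infty t = - int d"
proof -
  obtain c where t_def: "t = x - emb c" using t(1) by blast
  have *: "order_ge t (- int d)" "\<not> order_ge t (1 - int d)"
  proof -
    have "order_ge x (- int d)" "\<not> order_ge x (1 - int d)" using order_x x_nonzero by (auto simp: zero_of_order_ge_def)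
    moreover have "order_ge (emb a) (1 - int d)" "order_ge (emb a) (- int d)" for a
      using order_ge_const[of a] d by (auto intro: order_ge_mono)
    moreover have "t = x + emb (- c)" "x = t + emb c" by (simp_all add: t_def emb_simps)
    ultimately show "order_ge t (- int d)" "\<not> order_ge t (1 - int d)" using order_ge_add by metis+
  qed
  then show ?thesis using t_nonzero by (auto simp: zero_of_order_ge_def)
qed

text \<open>
These functions vanish at \<open>\<xi>\<close> to order \<open>N + i\<close>, while their poles at infinity have only order
\<open>N + i d\<close>.  For \<open>i \<le> r div d\<close> they belong to the space that defines the rows of the matrix for \<open>N + r\<close>.
\<close>

definition g :: "nat \<Rightarrow> 'f" where
  "g i = f * t ^ i"

lemma g: "g i \<noteq> 0" "\<xi> (g i) = int (N + i)" "infty (g i) = - int (N + i * d)" "regular_away_from emb infty (g i)"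
  unfolding g_def using f(1) t(2) t_nonzero f_orders t_pole f_regular t_regular
  by (simp_all add: xi.order_mult xi.order_power order_mult order_power regular_away_mult regular_away_power algebra_simps)

lemma g_pole_order: "N + i * d \<in> pole_orders emb infty"
  unfolding pole_orders_def pole_of_order_def using g[of i] by blast

text \<open>
The family adapted to \<open>\<xi>\<close>: it keeps the pole orders of \<open>y\<close>, but uses \<open>g i\<close> wherever the pole order has
the form \<open>N + i d\<close>.
\<close>

definition y' :: "nat \<Rightarrow> 'f" where
  "y' n = (if N \<le> delta emb infty n \<and> d dvd delta emb infty n - N
    then g ((delta emb infty n - N) div d) else y n)"

lemma y'_g:
  assumes "delta emb infty n = N + i * d"
  shows "y' n = g i"
  using assms d unfolding y'_def by simp

lemma pole_basis_y': "pole_basis y'"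
  unfolding pole_basis_def
proof (intro allI impI)
  fix n :: nat assume n: "1 \<le> n"
  show "regular_away_from emb infty (y' n) \<and> pole_of_order infty (y' n) (delta emb infty n)"
  proof (cases "\<exists>i. delta emb infty n = N + i * d")
    case True
    then obtain i where i: "delta emb infty n = N + i * d" by blast
    show ?thesis unfolding y'_g[OF i] i pole_of_order_def using g by blast
  next
    case False
    then have "y' n = y n" unfolding y'_def by (metis le_add_diff_inverse dvd_div_mult_self)
    then show ?thesis using y n unfolding pole_basis_def by simp
  qed
qed

lemma order_D_y':
  assumes "1 \<le> n"
  shows "zero_of_order_ge \<xi> (D k (y' n)) 0"
proof -
  have "zero_of_order_ge \<xi> (y' n) (int 0)"
    using pole_basis_y' assms xi.point ne
    unfolding pole_basis_def regular_away_from_def regular_at_def zero_of_order_ge_def by auto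
  then show ?thesis using order_D[OF xi.point ne unramified D, of _ 0 k] by simp
qed

lemma order_D_g: "zero_of_order_ge \<xi> (D k (g i)) (int N + int i - int k)"
  using order_D[OF xi.point ne unramified D, of "g i" "N + i" k] g(2)[of i]
  by (auto simp: zero_of_order_ge_def)

lemma order_det_change_basis:
  assumes "zero_of_order_ge \<xi> (det (mat n n (\<lambda>(i, j). D (\<kappa> j) (y' (i + 1))))) m"
    and "n = num_pole_orders emb infty M"
  shows "zero_of_order_ge \<xi> (det (mat n n (\<lambda>(i, j). D (\<kappa> j) (y (i + 1))))) m"
proof -
  have "hasse_schmidt_derivation emb D"
    using D unfolding hasse_schmidt_wrt_def by unfold_locales blast
  then obtain a where "det (mat n n (\<lambda>(i, j). D (\<kappa> j) (y (i + 1)))) =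
      emb a * det (mat n n (\<lambda>(i, j). D (\<kappa> j) (y' (i + 1))))"
    using det_change_basis[OF _ y pole_basis_y' assms(2)] by blast
  then show ?thesis using xi.order_ge_mult[OF xi.order_ge_const assms(1)] by simp
qed

text \<open>
Every term of the Leibniz formula for the adapted family \<open>y'\<close> contains an entry from the row of \<open>f = g 0\<close>.  In
column \<open>s j\<close> this entry is \<open>D (s j - 1) f\<close>, which vanishes to order at least \<open>N + 1 - s j\<close>, and the last
column gives the least bound.
\<close>

lemma order_Pi_minor:
  assumes mono: "strict_mono_on {1..num_pole_orders emb infty N} s"
    and ran: "s ` {1..num_pole_orders emb infty N} \<subseteq> {1..N}"
  shows "zero_of_order_ge \<xi> (Pi_minor emb infty D y N s) (int N + 1 - int (s (num_pole_orders emb infty N)))"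
proof -
  define n where "n = num_pole_orders emb infty N"
  define J where "J = (\<lambda>i. s i - 1) ` {1..n}"
  have ran': "1 \<le> s i \<and> s i \<le> N" if "i \<in> {1..n}" for i
  proof -
    have "s i \<in> {1..N}" using ran that unfolding n_def by blast
    then show ?thesis by simp
  qed
  have J: "J \<subseteq> {..<N}"
  proof
    fix j assume "j \<in> J"
    then obtain i where i: "i \<in> {1..n}" "j = s i - 1" unfolding J_def by blast
    then show "j \<in> {..<N}" using ran'[OF i(1)] by auto
  qed
  have "inj_on (\<lambda>i. s i - 1) {1..n}"
  proof (rule inj_onI)
    fix i j assume ij: "i \<in> {1..n}" "j \<in> {1..n}" "s i - 1 = s j - 1"
    then have "s i = s j" using ran'[OF ij(1)] ran'[OF ij(2)] ij(3) by linarith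
    then show "i = j" using ij(1,2) strict_mono_on_imp_inj_on[OF mono] unfolding n_def inj_on_def by blast
  qed
  then have card_J: "card J = n" unfolding J_def by (simp add: card_image)
  have J_le: "int (pick J j) \<le> int (s n) - 1" if "j < n" for j
  proof -
    have "pick J j \<in> J" using pick_in_set_le[of j J] card_J that by simp
    then obtain i where i: "i \<in> {1..n}" "pick J j = s i - 1" unfolding J_def by blast
    have "s i \<le> s n" 
      using strict_mono_on_leD[OF mono, of i n] i(1) unfolding n_def by auto
    moreover have "1 \<le> s i" using ran'[OF i(1)] by simp
    ultimately show ?thesis using i(2) by simp
  qed
  obtain k where k: "k \<in> {1..n}" "delta emb infty k = N"
    using delta_surj[OF infinite_pole_orders, of N N] g_pole_order[of 0] unfolding n_def by auto
  have "zero_of_order_ge \<xi> (det (mat n n (\<lambda>(i, j). D (pick J j) (y' (i + 1))))) (int N + 1 - int (s n))"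
  proof (rule xi.order_ge_det[where n = n and w = "\<lambda>i j. if i = k - 1 then int N + 1 - int (s n) else 0"])
    show "zero_of_order_ge \<xi> (mat n n (\<lambda>(i, j). D (pick J j) (y' (i + 1))) $$ (i, j))
        (if i = k - 1 then int N + 1 - int (s n) else 0)" if "i < n" "j < n" for i j
    proof (cases "i = k - 1")
      case True
      then have "y' (i + 1) = g 0" using y'_g[of k 0] k by simp
      then show ?thesis
        using xi.order_ge_mono[OF order_D_g[of "pick J j" 0], of "int N + 1 - int (s n)"] J_le[OF that(2)] that True by simp
    next
      case False
      then show ?thesis using order_D_y'[of "i + 1" "pick J j"] that by simp
    qed
    show "int N + 1 - int (s n) \<le> (\<Sum>i = 0..<n. if i = k - 1 then int N + 1 - int (s n) else 0)" for p :: "nat \<Rightarrow> nat"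
    proof -
      have "k - 1 < n" using k(1) by auto
      then show ?thesis by simp
    qed
  qed simp
  then have "zero_of_order_ge \<xi> (det (mat n n (\<lambda>(i, j). D (pick J j) (y (i + 1))))) (int N + 1 - int (s n))"
    by (rule order_det_change_basis) (rule n_def)
  then show ?thesis
    using Pi_minor_eq_det[of s emb infty N D y] J card_J unfolding J_def n_def by simp
qed

text \<open>
Every term of the Leibniz formula for the adapted family \<open>y'\<close> contains \<open>l\<close> entries from the rows of
\<open>g 0, \<dots>, g (l - 1)\<close>, in different columns.  Their orders add up to at least the sum of the \<open>N + i\<close> minus the
sum of the column numbers, which is at most that of the last \<open>l\<close> columns:
\<open>\<Sum>i<l. (N + i) - (n - 1 - i) = l (N + l - n)\<close>.
\<close>

lemma order_Delta_minor:
  fixes r :: nat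
  defines "l \<equiv> r div d + 1"
  defines "n \<equiv> num_pole_orders emb infty (N + r)"
  shows "zero_of_order_ge \<xi> (Delta_minor emb infty D y (N + r)) (int l * (int N + int l - int n))"
proof (cases "N + r < n")
  case True
  then show ?thesis using Delta_minor_eq_0[OF True[unfolded n_def]] by (simp add: zero_of_order_ge_def)
next
  case False
  have J: "(\<lambda>i. i - 1) ` {1..n} = {..<n}"
    by (auto simp: image_iff intro!: bexI[of _ "Suc _"])
  have pick: "pick {..<n} j = j" if "j < n" for j
    using pick_reduce_set[of j n UNIV] that by (simp add: pick_UNIV lessThan_def)
  have "\<exists>k\<in>{1..n}. delta emb infty k = N + i * d" if "i < l" for i
  proof -
    have "i * d \<le> r" using that d unfolding l_def
      by (metis add.commute less_Suc_eq_le plus_1_eq_Suc div_times_less_eq_dividend le_trans mult_le_mono1)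
    then show ?thesis using delta_surj[OF infinite_pole_orders g_pole_order] unfolding n_def by simp
  qed
  then obtain k where k: "\<And>i. i < l \<Longrightarrow> k i \<in> {1..n} \<and> delta emb infty (k i) = N + i * d" by metis
  \<comment> \<open>Rows are numbered from \<open>0\<close>, pole orders from \<open>1\<close>.\<close>
  define \<rho> where "\<rho> i = k i - 1" for i
  have rho: "\<rho> i < n" "y' (\<rho> i + 1) = g i" if "i < l" for i
    using k[OF that] y'_g[of "k i" i] unfolding \<rho>_def by auto
  have inj: "inj_on \<rho> {..<l}"
  proof (rule inj_onI)
    fix i j assume ij: "i \<in> {..<l}" "j \<in> {..<l}" "\<rho> i = \<rho> j"
    then have ki: "k i \<in> {1..n} \<and> delta emb infty (k i) = N + i * d"
      and kj: "k j \<in> {1..n} \<and> delta emb infty (k j) = N + j * d" using k by blast+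
    have "k i = k j" using ki kj ij(3) unfolding \<rho>_def by auto
    then have "N + i * d = N + j * d" using ki kj by metis
    then show "i = j" using d by simp
  qed
  define w where "w a b = (if a \<in> \<rho> ` {..<l} then int N + int (inv_into {..<l} \<rho> a) - int b else 0)" for a b
  have w_rho: "w (\<rho> i) b = int N + int i - int b" if "i < l" for i b
    unfolding w_def using that inv_into_f_f[OF inj] by auto
  have "zero_of_order_ge \<xi> (det (mat n n (\<lambda>(i, j). D j (y' (i + 1))))) (int l * (int N + int l - int n))"
  proof (rule xi.order_ge_det[where n = n and w = w])
    show "zero_of_order_ge \<xi> (mat n n (\<lambda>(i, j). D j (y' (i + 1))) $$ (a, b)) (w a b)" if "a < n" "b < n" for a b
    proof (cases "a \<in> \<rho> ` {..<l}")
      case True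
      then obtain i where i: "i < l" "a = \<rho> i" by blast
      then show ?thesis using order_D_g[of b i] rho[OF i(1)] that by (simp add: w_rho)
    next
      case False
      then show ?thesis using order_D_y'[of "a + 1" b] that unfolding w_def by simp
    qed
    fix p assume p: "p permutes {0..<n}"
    have "(\<Sum>a = 0..<n. w a (p a)) = (\<Sum>a\<in>\<rho> ` {..<l}. w a (p a))"
      using rho by (intro sum.mono_neutral_right) (auto simp: w_def)
    also have "\<dots> = (\<Sum>i<l. int N + int i - int (p (\<rho> i)))"
      using inj w_rho by (simp add: sum.reindex)
    also have "\<dots> = (\<Sum>i<l. int N + int i) - (\<Sum>i<l. int (p (\<rho> i)))"
      by (simp add: sum_subtractf)
    finally have sum_w: "(\<Sum>a = 0..<n. w a (p a)) = (\<Sum>i<l. int N + int i) - (\<Sum>i<l. int (p (\<rho> i)))" .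
    let ?S = "(\<lambda>i. p (\<rho> i)) ` {..<l}"
    have inj_p: "inj_on (\<lambda>i. p (\<rho> i)) {..<l}"
      using inj permutes_inj[OF p] unfolding inj_on_def by blast
    have "?S \<subseteq> {..<n}" using rho(1) permutes_in_image[OF p] by auto
    from sum_le_sum_largest[OF this]
    have "(\<Sum>i<l. int (p (\<rho> i))) \<le> (\<Sum>i<l. int n - 1 - int i)"
      using inj_p by (simp add: sum.reindex card_image)
    moreover have "(\<Sum>i<l. int N + int i) - (\<Sum>i<l. int n - 1 - int i) = int l * (int N + int l - int n)" for l
      by (induct l) (simp_all add: algebra_simps)
    ultimately show "int l * (int N + int l - int n) \<le> (\<Sum>a = 0..<n. w a (p a))"
      unfolding sum_w by (metis diff_left_mono)
  qed simp
  then have "zero_of_order_ge \<xi> (det (mat n n (\<lambda>(i, j). D j (y (i + 1))))) (int l * (int N + int l - int n))"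
    by (rule order_det_change_basis) (rule n_def[THEN meta_eq_to_obj_eq])
  moreover have "mat n n (\<lambda>(i, j). D (pick {..<n} j) (y (i + 1))) = mat n n (\<lambda>(i, j). D j (y (i + 1)))"
    by (rule cong_mat) (auto simp: pick)
  ultimately show ?thesis
    using Pi_minor_eq_det[of "\<lambda>i. i" emb infty "N + r" D y] J False
    unfolding Delta_minor_def by (simp flip: n_def)
qed

end

text \<open>
If \<open>x\<close> has a simple pole, its powers realise every pole order.
\<close>

lemma (in curve) too_many_pole_orders:
  assumes "d = 1"
  shows "M < num_pole_orders emb infty M"
proof -
  have "n \<in> pole_orders emb infty" for n
    unfolding pole_orders_def pole_of_order_def
    using regular_away_power[OF x_regular, of n] order_power[OF x_nonzero, of n] x_nonzero order_x assms
    by (intro CollectI exI[of _ "x ^ n"]) simp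
  then have "{..M} \<subseteq> delta emb infty ` {1..num_pole_orders emb infty M}"
    using delta_surj[OF infinite_pole_orders] by (metis atMost_iff imageI subsetI)
  then have "card {..M} \<le> num_pole_orders emb infty M"
    using surj_card_le[of "{1..num_pole_orders emb infty M}" "{..M}"] by simp
  then show ?thesis by simp
qed

theorem proposition5p1:
  fixes emb :: "'k::alg_closed_field \<Rightarrow> 'f::field"
    and infty \<xi> :: "'f point"
    and x :: 'f
    and y :: "nat \<Rightarrow> 'f"
    and D :: "nat \<Rightarrow> 'f \<Rightarrow> 'f"
    and d N r :: nat
  assumes "function_field emb" and "genus emb \<ge> 2"
    and "infty \<in> points emb"
    and "d \<ge> 1" and "regular_away_from emb infty x" and "pole_of_order infty x d"
    and "separable_ext_of (ratfuns emb x)"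
    and "hasse_schmidt_wrt emb x D"
    and "\<forall>n\<ge>1. regular_away_from emb infty (y n) \<and> pole_of_order infty (y n) (delta emb infty n)"
    and "N \<ge> 2"
    and "\<xi> \<in> torsion_points emb infty N" and "\<xi> \<notin> ramification_points emb x"
  shows "(\<forall>s. strict_mono_on {1..num_pole_orders emb infty N} s
              \<and> s ` {1..num_pole_orders emb infty N} \<subseteq> {1..N} \<longrightarrow>
            zero_of_order_ge \<xi> (Pi_minor emb infty D y N s)
              (int N + 1 - int (s (num_pole_orders emb infty N))))
       \<and> (let l = int (r div d) + 1 in
            zero_of_order_ge \<xi> (Delta_minor emb infty D y (N + r))
              (l * (int N + l - int (num_pole_orders emb infty (N + r)))))"
proof -
  interpret constant_embedding emb
    using assms(1) unfolding function_field_def by (intro constant_embedding.intro) blast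
  interpret curve emb infty x d
    using assms(1,3-7) by unfold_locales
  have xi: "\<xi> \<in> points emb" using assms(11) unfolding torsion_points_def by blast
  show ?thesis
  proof (cases "\<xi> = infty")
    case True
    \<comment> \<open>An unramified point at infinity forces \<open>d = 1\<close>.  The matrix then has more rows than columns: there
      are no admissible \<open>s\<close>, and the minor for \<open>N + r\<close> is \<open>0\<close>.\<close>
    have "d = 1"
    proof (rule ccontr)
      assume "d \<noteq> 1"
      then have "infty (1 / x) \<ge> 2" "infty x < 0" using d order_x x_nonzero by (simp_all add: order_divide)
      then show False using assms(12) xi True unfolding ramification_points_def by blast
    qed
    note lt = too_many_pole_orders[OF this]
    have "\<not> s ` {1..num_pole_orders emb infty N} \<subseteq> {1..N}"
      if "strict_mono_on {1..num_pole_orders emb infty N} s" for s :: "nat \<Rightarrow> nat"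
    proof
      assume "s ` {1..num_pole_orders emb infty N} \<subseteq> {1..N}"
      then have "card {1..num_pole_orders emb infty N} \<le> card {1..N}"
        using strict_mono_on_imp_inj_on[OF that] by (intro card_inj_on_le) auto
      then show False using lt[of N] by simp
    qed
    then show ?thesis
      using Delta_minor_eq_0[OF lt[of "N + r"]] by (auto simp: zero_of_order_ge_def Let_def)
  next
    case ne: False
    obtain f where f: "f \<noteq> 0" "\<And>\<zeta>. \<zeta> \<in> points emb \<Longrightarrow>
        \<zeta> f = (if \<zeta> = \<xi> then int N else 0) - (if \<zeta> = infty then int N else 0)"
      using torsion_function[OF assms(11,3) constant_embedding_axioms] by blast
    obtain c where c: "\<xi> (x - emb c) = 1"
      using unramified_uniformizer[OF xi ne assms(12,8)] by blast
    interpret unramified_torsion_point emb infty x d \<xi> D y N f "x - emb c"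
      by unfold_locales (use xi ne assms(8,9,12) f c in \<open>auto simp: pole_basis_def\<close>)
    have "int (r div d) + 1 = int (r div d + 1)" by simp
    then show ?thesis
      using order_Pi_minor order_Delta_minor[of r] unfolding Let_def by metis
  qed
qed

end
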